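(* There exists a Cayley automatic group $G$ separated from automatic groups but for which the Cayley distance function $h_{\psi,\alpha}$ vanishes for some Cayley p.f. linear-time computable representation $\psi:L\to G$, $L\subseteq\Sigma^*$, and some mapping $\alpha:\Sigma\to G$.
   Context: Let $G$ be a finitely generated group with a finite generating set $A$, and $S=A\cup A^{-1}$. Cayley automatic: $G$ is Cayley automatic if there are a regular language $L\subseteq\Sigma^*$ over a finite alphabet $\Sigma$ and a bijection $\psi:L\to G$ (a Cayley automatic representation) such that for every $s\in S$ the relation $\{(u,v)\in L\times L\mid\psi(u)s=\psi(v)\}$ is recognized by a two-tape synchronous automaton. Position-faithful one-tape Turing machine: a Turing machine with one semi-infinite tape (infinite in one direction only) whose left-most cell contains a special symbol $\boxplus$ which occurs only there and cannot be modified. On input $x\in\Sigma^*$ the initial tape content is $\boxplus x\boxdot^\infty$, where $\boxdot$ is a special blank symbol and $\Sigma\cap\{\boxplus,\boxdot\}=\varnothing$, and the head starts at $\boxplus$. The machine computes $f:\Sigma^*\to\Sigma^*$ if on every input $x\in\Sigma^*$ it eventually reaches an accepting state and halts with the tape having prefix $\boxplus f(x)\boxdot$ (no restriction on the tape content after this first $\boxdot$). A function $f:\Sigma^*\to\Sigma^*$ is position-faithful (p.f.) linear-time computable if it is computed by a deterministic position-faithful one-tape Turing machine in time linear in the input length. A Cayley p.f. linear-time computable representation of $G$ is a bijection $\psi:L\to G$, where $L\subseteq\Sigma^*$ is a language over a finite alphabet $\Sigma$ (not necessarily regular), for which there exist p.f. linear-time computable functions $f_s:\Sigma^*\to\Sigma^*$,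 $s\in S$, with $f_s(L)\subseteq L$ and $\psi(f_s(w))=\psi(w)s$ for all $w\in L$. Cayley distance function: for a bijection $\psi:L\to G$, $L\subseteq\Sigma^*$, and a mapping $\alpha:\Sigma\to G$ (not necessarily injective), let $\pi_\alpha:L\to G$ be $\pi_\alpha(\sigma_1\dots\sigma_k)=\alpha(\sigma_1)\cdots\alpha(\sigma_k)$, with $\pi_\alpha(\epsilon)=e$. Let $L^{\leqslant n}=\{w\in L\mid|w|\leqslant n\}$ and $N=\min\{n\in\mathbb{N}\mid L^{\leqslant n}\neq\varnothing\}$. Then $h_{\psi,\alpha}:[N,+\infty)\to\mathbb{R}^+$ is $$h_{\psi,\alpha}(n)=\max\{d_A(\pi_\alpha(w),\psi(w))\mid w\in L^{\leqslant n}\},$$ where $d_A(g,h)$ is the length of a shortest word over $A\cup A^{-1}$ representing $g^{-1}h$. Here $[N,+\infty)$ is understood as the set of integers $n\geqslant N$ and $\mathbb{R}^+$ contains $0$. The function $h_{\psi,\alpha}$ vanishes if $h_{\psi,\alpha}(n)=0$ for all $n$ in its domain. For nondecreasing functions $h_1:[N_1,+\infty)\to\mathbb{R}^+$ and $h_2:[N_2,+\infty)\to\mathbb{R}^+$, write $h_1\preceq h_2$ if there exist integer constants $K,M>0$ and $N_0\geqslant\max\{N_1,N_2\}$ such that $h_1(n)\leqslant Kh_2(Mn)$ for all $n\geqslant N_0$. A Cayley automatic group $G$ is separated from automatic groups if there exists a nondecreasing unbounded function $f$ such that $f\preceq h_{\psi,\alpha}$ for all Cayley automatic representations $\psi:L\to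 G$, $L\subseteq\Sigma^*$, and all mappings $\alpha:\Sigma\to G$. *)

theory Defs
  imports Complex_Main "HOL-Library.FuncSet" "HOL-Algebra.Generated_Groups"
begin

record ('q, 'a) dfa =
  dfa_states :: "'q set"
  dfa_init :: 'q
  dfa_final :: "'q set"
  dfa_next :: "'q \<Rightarrow> 'a \<Rightarrow> 'q"

definition dfa_over :: "'a set \<Rightarrow> ('q, 'a) dfa \<Rightarrow> bool" where
  "dfa_over \<Sigma> M \<longleftrightarrow>
     finite (dfa_states M) \<and> dfa_init M \<in> dfa_states M \<and> dfa_final M \<subseteq> dfa_states M \<and>
     (\<forall>q\<in>dfa_states M. \<forall>a\<in>\<Sigma>. dfa_next M q a \<in> dfa_states M)"

definition dfa_language :: "'a set \<Rightarrow> ('q, 'a) dfa \<Rightarrow> 'a list set" where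
  "dfa_language \<Sigma> M = {w \<in> lists \<Sigma>. foldl (dfa_next M) (dfa_init M) w \<in> dfa_final M}"

text \<open>State sets are finite, so states may be taken to be natural numbers.\<close>

definition regular_language :: "'a set \<Rightarrow> 'a list set \<Rightarrow> bool" where
  "regular_language \<Sigma> L \<longleftrightarrow>
     (\<exists>M :: (nat, 'a) dfa. dfa_over \<Sigma> M \<and> L = dfa_language \<Sigma> M)"

text \<open>\<^term>\<open>None\<close> is the padding symbol appended to the shorter word.\<close>

fun convolution :: "'a list \<Rightarrow> 'a list \<Rightarrow> ('a option \<times> 'a option) list" where
  "convolution [] [] = []"
| "convolution (a # u) [] = (Some a, None) # convolution u []"
| "convolution [] (b # v) = (None, Some b) # convolution [] v"
| "convolution (a # u) (b # v) = (Some a, Some b) # convolution u v"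

definition padded_pairs :: "'a set \<Rightarrow> ('a option \<times> 'a option) set" where
  "padded_pairs \<Sigma> =
     (insert None (Some ` \<Sigma>) \<times> insert None (Some ` \<Sigma>)) - {(None, None)}"

text \<open>A synchronous two-tape automaton reads both words letter by letter in parallel, i.e. it is
  a finite automaton over the padded pair alphabet reading the convolution.\<close>

definition sync_recognizable :: "'a set \<Rightarrow> ('a list \<times> 'a list) set \<Rightarrow> bool" where
  "sync_recognizable \<Sigma> R \<longleftrightarrow>
     R \<subseteq> lists \<Sigma> \<times> lists \<Sigma> \<and>
     regular_language (padded_pairs \<Sigma>) ((\<lambda>(u, v). convolution u v) ` R)"

text \<open>\<open>Boundary\<close> is the special symbol of the left-most cell and \<open>Blank\<close> the
  blank symbol; as constructors they are distinct from all letters.\<close>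

datatype 'a cell = Boundary | Blank | Letter 'a

datatype move = MoveLeft | Stay | MoveRight

record ('q, 'a) tm =
  tm_states :: "'q set"
  tm_letters :: "'a set"
  tm_init :: 'q
  tm_accept :: "'q set"
  tm_next :: "'q \<Rightarrow> 'a cell \<Rightarrow> 'q \<times> 'a cell \<times> move"

definition tm_cells :: "('q, 'a) tm \<Rightarrow> 'a cell set" where
  "tm_cells M = {Boundary, Blank} \<union> Letter ` tm_letters M"

text \<open>The work alphabet may contain letters outside the input alphabet. The boundary symbol is
  never overwritten, never written elsewhere, and the head never moves left from it.\<close>

definition pf_tm :: "'a set \<Rightarrow> ('q, 'a) tm \<Rightarrow> bool" where
  "pf_tm \<Sigma> M \<longleftrightarrow>
     finite (tm_states M) \<and> finite (tm_letters M) \<and> \<Sigma> \<subseteq> tm_letters M \<and>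
     tm_init M \<in> tm_states M \<and> tm_accept M \<subseteq> tm_states M \<and>
     (\<forall>q \<in> tm_states M. \<forall>a \<in> tm_cells M.
        case tm_next M q a of (q', b, d) \<Rightarrow>
          q' \<in> tm_states M \<and> b \<in> tm_cells M \<and>
          (b = Boundary \<longleftrightarrow> a = Boundary) \<and>
          (a = Boundary \<longrightarrow> d \<noteq> MoveLeft))"

text \<open>A configuration consists of the state, the tape content and the head position.\<close>

type_synonym ('q, 'a) config = "'q \<times> (nat \<Rightarrow> 'a cell) \<times> nat"

fun move_head :: "move \<Rightarrow> nat \<Rightarrow> nat" where
  "move_head MoveLeft p = p - 1"
| "move_head Stay p = p"
| "move_head MoveRight p = Suc p"

text \<open>The machine halts exactly in its accepting states. A machine stuck in a non-accepting
  state computes nothing, so a total transition function loses no generality.\<close>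

fun tm_step :: "('q, 'a) tm \<Rightarrow> ('q, 'a) config \<Rightarrow> ('q, 'a) config" where
  "tm_step M (q, T, p) =
     (if q \<in> tm_accept M then (q, T, p)
      else case tm_next M q (T p) of (q', b, d) \<Rightarrow> (q', T(p := b), move_head d p))"

definition input_tape :: "'a list \<Rightarrow> nat \<Rightarrow> 'a cell" where
  "input_tape x i =
     (if i = 0 then Boundary else if i \<le> length x then Letter (x ! (i - 1)) else Blank)"

definition tm_run :: "('q, 'a) tm \<Rightarrow> 'a list \<Rightarrow> nat \<Rightarrow> ('q, 'a) config" where
  "tm_run M x t = (tm_step M ^^ t) (tm_init M, input_tape x, 0)"

definition tape_has_output :: "(nat \<Rightarrow> 'a cell) \<Rightarrow> 'a list \<Rightarrow> bool" where
  "tape_has_output T y \<longleftrightarrow> map T [0..<length y + 2] = Boundary # map Letter y @ [Blank]"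

definition tm_computes_within ::
    "'a set \<Rightarrow> ('q, 'a) tm \<Rightarrow> ('a list \<Rightarrow> 'a list) \<Rightarrow> (nat \<Rightarrow> nat) \<Rightarrow> bool" where
  "tm_computes_within \<Sigma> M f \<tau> \<longleftrightarrow>
     (\<forall>x \<in> lists \<Sigma>. \<exists>t \<le> \<tau> (length x). case tm_run M x t of (q, T, p) \<Rightarrow>
        q \<in> tm_accept M \<and> tape_has_output T (f x))"

definition pf_linear_time :: "'a set \<Rightarrow> ('a list \<Rightarrow> 'a list) \<Rightarrow> bool" where
  "pf_linear_time \<Sigma> f \<longleftrightarrow>
     f \<in> lists \<Sigma> \<rightarrow> lists \<Sigma> \<and>
     (\<exists>(M :: (nat, 'a) tm) c d. pf_tm \<Sigma> M \<and> tm_computes_within \<Sigma> M f (\<lambda>n. c * n + d))"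

text \<open>Finitely generated groups are countable, so an existence claim about them may be made for
  groups whose elements are natural numbers.\<close>

definition finite_generating_set :: "('g, 'm) monoid_scheme \<Rightarrow> 'g set \<Rightarrow> bool" where
  "finite_generating_set G A \<longleftrightarrow>
     finite A \<and> A \<subseteq> carrier G \<and> generate G A = carrier G"

definition sym_gens :: "('g, 'm) monoid_scheme \<Rightarrow> 'g set \<Rightarrow> 'g set" where
  "sym_gens G A = A \<union> (\<lambda>a. inv\<^bsub>G\<^esub> a) ` A"

definition word_prod :: "('g, 'm) monoid_scheme \<Rightarrow> 'g list \<Rightarrow> 'g" where
  "word_prod G gs = foldr (\<lambda>g h. g \<otimes>\<^bsub>G\<^esub> h) gs \<one>\<^bsub>G\<^esub>"

definition word_dist :: "('g, 'm) monoid_scheme \<Rightarrow> 'g set \<Rightarrow> 'g \<Rightarrow> 'g \<Rightarrow> nat" where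
  "word_dist G A g h =
     (LEAST n. \<exists>w \<in> lists (sym_gens G A).
        length w = n \<and> word_prod G w = inv\<^bsub>G\<^esub> g \<otimes>\<^bsub>G\<^esub> h)"

definition cayley_automatic_rep ::
    "('g, 'm) monoid_scheme \<Rightarrow> 'g set \<Rightarrow> 'a set \<Rightarrow> 'a list set \<Rightarrow> ('a list \<Rightarrow> 'g) \<Rightarrow> bool" where
  "cayley_automatic_rep G A \<Sigma> L \<psi> \<longleftrightarrow>
     finite \<Sigma> \<and> L \<subseteq> lists \<Sigma> \<and> regular_language \<Sigma> L \<and> bij_betw \<psi> L (carrier G) \<and>
     (\<forall>s \<in> sym_gens G A.
        sync_recognizable \<Sigma> {(u, v) \<in> L \<times> L. \<psi> u \<otimes>\<^bsub>G\<^esub> s = \<psi> v})"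

text \<open>Alphabets are finite, so letters may be taken to be natural numbers.\<close>

definition cayley_automatic :: "('g, 'm) monoid_scheme \<Rightarrow> 'g set \<Rightarrow> bool" where
  "cayley_automatic G A \<longleftrightarrow>
     (\<exists>(\<Sigma> :: nat set) L \<psi>. cayley_automatic_rep G A \<Sigma> L \<psi>)"

definition cayley_pf_linear_time_rep ::
    "('g, 'm) monoid_scheme \<Rightarrow> 'g set \<Rightarrow> 'a set \<Rightarrow> 'a list set \<Rightarrow> ('a list \<Rightarrow> 'g) \<Rightarrow> bool" where
  "cayley_pf_linear_time_rep G A \<Sigma> L \<psi> \<longleftrightarrow>
     finite \<Sigma> \<and> L \<subseteq> lists \<Sigma> \<and> bij_betw \<psi> L (carrier G) \<and>
     (\<forall>s \<in> sym_gens G A. \<exists>f. pf_linear_time \<Sigma> f \<and> f ` L \<subseteq> L \<and>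
        (\<forall>w \<in> L. \<psi> (f w) = \<psi> w \<otimes>\<^bsub>G\<^esub> s))"

definition lang_upto :: "'a list set \<Rightarrow> nat \<Rightarrow> 'a list set" where
  "lang_upto L n = {w \<in> L. length w \<le> n}"

definition lang_min_length :: "'a list set \<Rightarrow> nat" where
  "lang_min_length L = (LEAST n. lang_upto L n \<noteq> {})"

text \<open>Only meaningful for arguments \<open>n \<ge> lang_min_length L\<close>, where the maximum is taken over
  a nonempty set; it is finite if the alphabet is.\<close>

definition cayley_distance ::
    "('g, 'm) monoid_scheme \<Rightarrow> 'g set \<Rightarrow> 'a list set \<Rightarrow> ('a list \<Rightarrow> 'g) \<Rightarrow> ('a \<Rightarrow> 'g) \<Rightarrow> nat \<Rightarrow> real"
  where
  "cayley_distance G A L \<psi> \<alpha> n =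
     Max ((\<lambda>w. real (word_dist G A (word_prod G (map \<alpha> w)) (\<psi> w))) ` lang_upto L n)"

definition cayley_distance_vanishes ::
    "('g, 'm) monoid_scheme \<Rightarrow> 'g set \<Rightarrow> 'a list set \<Rightarrow> ('a list \<Rightarrow> 'g) \<Rightarrow> ('a \<Rightarrow> 'g) \<Rightarrow> bool" where
  "cayley_distance_vanishes G A L \<psi> \<alpha> \<longleftrightarrow>
     (\<forall>n \<ge> lang_min_length L. cayley_distance G A L \<psi> \<alpha> n = 0)"

text \<open>\<open>dominated N1 h1 N2 h2\<close> is the relation \<open>h1 \<preceq> h2\<close> for functions \<open>h1\<close>, \<open>h2\<close> with
  domains \<open>{N1..}\<close>, \<open>{N2..}\<close>.\<close>

definition dominated :: "nat \<Rightarrow> (nat \<Rightarrow> real) \<Rightarrow> nat \<Rightarrow> (nat \<Rightarrow> real) \<Rightarrow> bool" where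
  "dominated N1 h1 N2 h2 \<longleftrightarrow>
     (\<exists>(K :: nat) (M :: nat) N0. K > 0 \<and> M > 0 \<and> N0 \<ge> max N1 N2 \<and>
        (\<forall>n \<ge> N0. h1 n \<le> real K * h2 (M * n)))"

definition separated_from_automatic :: "('g, 'm) monoid_scheme \<Rightarrow> 'g set \<Rightarrow> bool" where
  "separated_from_automatic G A \<longleftrightarrow>
     (\<exists>N1 (f :: nat \<Rightarrow> real).
        (\<forall>n \<ge> N1. f n \<ge> 0) \<and> mono_on {N1..} f \<and> \<not> bdd_above (f ` {N1..}) \<and>
        (\<forall>(\<Sigma> :: nat set) L \<psi> \<alpha>.
           cayley_automatic_rep G A \<Sigma> L \<psi> \<longrightarrow> \<alpha> \<in> \<Sigma> \<rightarrow> carrier G \<longrightarrow>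
           dominated N1 f (lang_min_length L) (cayley_distance G A L \<psi> \<alpha>)))"

end

theory Submission
  imports Defs "HOL-Library.FSet"
begin

text \<open>
  The group is the lamplighter group: an element is a pair \<open>(f, n)\<close> of a finite set \<open>f\<close> of lit lamps
  on the integers and a position \<open>n\<close> of the lamplighter. The generator \<open>a\<close> toggles the lamp at the
  current position, and \<open>t\<close> and \<open>T\<close>, its inverse, move one step forwards and backwards.

  \<^bold>\<open>Separation.\<close> Let \<open>\<psi>\<close> be a Cayley automatic representation on \<open>L\<close>, and let \<open>h\<close> be its distance
  function for some \<open>\<alpha>\<close>. If \<open>u\<close> and \<open>v\<close> in \<open>L\<close> represent neighbours \<open>g\<close> and \<open>g s\<close>, then a finite
  automaton reads the pair, so any two prefixes of \<open>u\<close> and \<open>v\<close> of the same length have boundedly long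
  extensions that again represent neighbours. Hence the paths that \<open>u\<close> and \<open>v\<close> trace through \<open>\<alpha>\<close> stay
  within distance \<open>2 h + O(1)\<close> of each other. Along a loop of length \<open>l\<close> these paths have length
  \<open>O(l)\<close>, and together they cut the loop into loops of length \<open>O(h(M l) + 1)\<close>. Now suppose that the
  words over the generators act on a set in such a way that all loops shorter than \<open>k\<close> act trivially
  but some loop of length \<open>O(k)\<close> does not. Then \<open>h(M k)\<close> cannot be small against \<open>k\<close>
  (\<open>distance_grows\<close>), and the identity is a lower bound for all distance functions
  (\<open>separated_from_automaticI\<close>). In the lamplighter group two lamps commute for a reason that is only
  visible in loops as long as their distance. For every \<open>k\<close> there is a central extension by a group of
  order two in which two lamps commute unless their distance is exactly \<open>k\<close>; it
  sees the commutator of the lamps at \<open>0\<close> and \<open>k\<close>, but no loop shorter than \<open>k\<close>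
  (\<open>cover_act_short\<close>).

  \<^bold>\<open>Automatic representation.\<close> The line is folded at the origin, so that one letter holds the two
  lamps \<open>j\<close> and \<open>- 1 - j\<close>. Words then grow at one end only, and multiplication by a generator changes
  letters next to the lamplighter. Such a change is checked by comparing neighbouring letters
  (\<open>sync_recognizable_local\<close>).

  \<^bold>\<open>A representation with vanishing distance.\<close> Here a word has to be a path to its element. It walks to
  the left end of the relevant interval, then to the right end while setting the lamps, and then
  back to the lamplighter. The letter at which the walk will end is marked, so that it can be found
  from the left. The language is not regular: the number of steps back is the number of letters from
  the mark on, which no finite automaton checks. But no function has to check it. Multiplication
  by a generator moves the mark by at most one place, adds or removes at most three letters, and so is
  computed in one sweep to the right and one sweep to the left over the tape
  (\<open>pf_linear_time_two_sweeps\<close>).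
\<close>

section \<open>Words over a generating set\<close>

context group
begin

lemma word_prod_Nil [simp]: "word_prod G [] = \<one>"
  by (simp add: word_prod_def)

lemma word_prod_Cons [simp]: "word_prod G (g # w) = g \<otimes> word_prod G w"
  by (simp add: word_prod_def)

lemma word_prod_closed [simp]: "w \<in> lists (carrier G) \<Longrightarrow> word_prod G w \<in> carrier G"
  by (induction w) auto

lemma word_prod_append [simp]:
  "u \<in> lists (carrier G) \<Longrightarrow> v \<in> lists (carrier G) \<Longrightarrow>
   word_prod G (u @ v) = word_prod G u \<otimes> word_prod G v"
  by (induction u) (auto simp: m_assoc simp del: in_lists_conv_set)

lemma sym_gens_closed: "A \<subseteq> carrier G \<Longrightarrow> sym_gens G A \<subseteq> carrier G"
  by (auto simp: sym_gens_def)

lemma sym_gens_inv: "A \<subseteq> carrier G \<Longrightarrow> s \<in> sym_gens G A \<Longrightarrow> inv s \<in> sym_gens G A"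
  by (auto simp: sym_gens_def)

definition inv_word :: "'a list \<Rightarrow> 'a list" where
  "inv_word w = rev (map (\<lambda>g. inv g) w)"

lemma length_inv_word [simp]: "length (inv_word w) = length w"
  by (simp add: inv_word_def)

lemma inv_word_Nil [simp]: "inv_word [] = []"
  and inv_word_Cons: "inv_word (g # w) = inv_word w @ [inv g]"
  by (simp_all add: inv_word_def)

lemma inv_word_gens:
  "A \<subseteq> carrier G \<Longrightarrow> w \<in> lists (sym_gens G A) \<Longrightarrow> inv_word w \<in> lists (sym_gens G A)"
  by (induction w) (auto simp: inv_word_Cons sym_gens_inv simp del: in_lists_conv_set)

lemma word_prod_inv_word:
  "w \<in> lists (carrier G) \<Longrightarrow>
   inv_word w \<in> lists (carrier G) \<and> word_prod G (inv_word w) = inv (word_prod G w)"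
  by (induction w) (auto simp: inv_word_Cons inv_mult_group simp del: in_lists_conv_set)

lemma gens_words_closed:
  "A \<subseteq> carrier G \<Longrightarrow> w \<in> lists (sym_gens G A) \<Longrightarrow> w \<in> lists (carrier G)"
  using sym_gens_closed by blast

lemma generate_as_word:
  assumes "A \<subseteq> carrier G" and "g \<in> generate G A"
  shows "\<exists>w \<in> lists (sym_gens G A). word_prod G w = g"
  using assms(2)
proof induction
  case one
  show ?case by (rule bexI[of _ "[]"]) auto
next
  case (incl h)
  then show ?case using assms(1)
    by (intro bexI[of _ "[h]"]) (auto simp: sym_gens_def)
next
  case (inv h)
  then show ?case using assms(1)
    by (intro bexI[of _ "[inv h]"]) (auto simp: sym_gens_def)
next
  case (eng h1 h2)
  then obtain u v where "u \<in> lists (sym_gens G A)" "v \<in> lists (sym_gens G A)"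
    "word_prod G u = h1" "word_prod G v = h2" by blast
  then show ?case using assms(1)
    by (intro bexI[of _ "u @ v"]) (auto simp: gens_words_closed simp del: in_lists_conv_set)
qed

lemma word_dist_witness:
  assumes "finite_generating_set G A" "g \<in> carrier G" "h \<in> carrier G"
  shows "\<exists>w \<in> lists (sym_gens G A). length w = word_dist G A g h \<and> g \<otimes> word_prod G w = h"
proof -
  have A: "A \<subseteq> carrier G" and gen: "generate G A = carrier G"
    using assms(1) by (auto simp: finite_generating_set_def)
  let ?P = "\<lambda>n. \<exists>w \<in> lists (sym_gens G A). length w = n \<and> word_prod G w = inv g \<otimes> h"
  obtain w0 where "w0 \<in> lists (sym_gens G A)" "word_prod G w0 = inv g \<otimes> h"
    using generate_as_word[OF A, of "inv g \<otimes> h"] assms gen by auto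
  hence "?P (length w0)" by blast
  hence "?P (word_dist G A g h)"
    unfolding word_dist_def by (rule LeastI)
  then obtain w where "w \<in> lists (sym_gens G A)" "length w = word_dist G A g h"
     "word_prod G w = inv g \<otimes> h" by blast
  moreover have "g \<otimes> (inv g \<otimes> h) = h" using assms
    by (simp flip: m_assoc)
  ultimately show ?thesis by metis
qed

lemma word_dist_self: "g \<in> carrier G \<Longrightarrow> word_dist G A g g = 0"
  unfolding word_dist_def by (rule Least_eq_0) (auto intro!: bexI[of _ "[]"])

end

lemma word_dist_le_cayley_distance:
  assumes "finite \<Sigma>" "L \<subseteq> lists \<Sigma>" "w \<in> L" "length w \<le> n"
  shows "real (word_dist G A (word_prod G (map \<alpha> w)) (\<psi> w)) \<le> cayley_distance G A L \<psi> \<alpha> n"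
proof -
  have "lang_upto L n \<subseteq> {w. set w \<subseteq> \<Sigma> \<and> length w \<le> n}"
    using assms(2) by (auto simp: lang_upto_def)
  hence "finite (lang_upto L n)"
    using finite_lists_length_le[OF assms(1)] finite_subset by blast
  thus ?thesis
    unfolding cayley_distance_def using assms by (intro Max_ge) (auto simp: lang_upto_def)
qed

section \<open>Regular languages\<close>

lemma dfa_state_closed:
  "dfa_over \<Sigma> M \<Longrightarrow> w \<in> lists \<Sigma> \<Longrightarrow> q \<in> dfa_states M \<Longrightarrow> foldl (dfa_next M) q w \<in> dfa_states M"
  by (induction w arbitrary: q) (auto simp: dfa_over_def)

text \<open>For each state choose one continuation that satisfies \<open>Q\<close> and leads to acceptance, if there is one;
there are finitely many states. Two choices of \<open>Q\<close> matter below: no condition at all, and the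
condition that the first of the two tapes has ended.\<close>

lemma short_continuation:
  assumes "regular_language \<Sigma> K"
  shows "\<exists>C. \<forall>x y. x @ y \<in> K \<longrightarrow> Q y \<longrightarrow> (\<exists>y'. x @ y' \<in> K \<and> Q y' \<and> length y' \<le> C)"
proof -
  obtain M :: "(nat, 'a) dfa" where M: "dfa_over \<Sigma> M" and K: "K = dfa_language \<Sigma> M"
    using assms by (auto simp: regular_language_def)
  define good where "good q y \<longleftrightarrow> y \<in> lists \<Sigma> \<and> Q y \<and> foldl (dfa_next M) q y \<in> dfa_final M" for q y
  define pick where "pick q = (SOME y. good q y)" for q
  have "finite (dfa_states M)" using M by (simp add: dfa_over_def)
  then obtain C where C: "\<forall>q\<in>dfa_states M. length (pick q) \<le> C"
    using finite_nat_set_iff_bounded_le[of "(\<lambda>q. length (pick q)) ` dfa_states M"] by auto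
  show ?thesis
  proof (intro exI[of _ C] allI impI)
    fix x y assume "x @ y \<in> K" "Q y"
    define q where "q = foldl (dfa_next M) (dfa_init M) x"
    have x: "x \<in> lists \<Sigma>" and "good q y"
      using \<open>x @ y \<in> K\<close> \<open>Q y\<close> by (auto simp: K dfa_language_def good_def q_def)
    hence "good q (pick q)" unfolding pick_def by (metis someI)
    moreover have "q \<in> dfa_states M" unfolding q_def
      using dfa_state_closed[OF M x] M by (simp add: dfa_over_def)
    ultimately show "\<exists>y'. x @ y' \<in> K \<and> Q y' \<and> length y' \<le> C"
      using C x by (intro exI[of _ "pick q"]) (auto simp: K dfa_language_def good_def q_def)
  qed
qed

text \<open>A right congruence of finite index that saturates \<open>K\<close>, presented as a map \<open>st\<close> to invariants of words.
It spares the construction of an automaton: the states are the values of \<open>st\<close>, and a transition appends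
the letter to an arbitrary representative.\<close>

lemma regular_languageI:
  assumes fin: "finite (st ` lists \<Sigma>)"
    and step: "\<And>u v a. u \<in> lists \<Sigma> \<Longrightarrow> v \<in> lists \<Sigma> \<Longrightarrow> a \<in> \<Sigma> \<Longrightarrow> st u = st v \<Longrightarrow> st (u @ [a]) = st (v @ [a])"
    and final: "\<And>w. w \<in> lists \<Sigma> \<Longrightarrow> w \<in> K \<longleftrightarrow> F (st w)" and K: "K \<subseteq> lists \<Sigma>"
  shows "regular_language \<Sigma> K"
proof -
  obtain code :: "_ \<Rightarrow> nat" where code: "inj_on code (st ` lists \<Sigma>)"
    using finite_imp_inj_to_nat_seg[OF fin] by blast
  define cst where "cst w = code (st w)" for w
  define rep where "rep q = (SOME w. w \<in> lists \<Sigma> \<and> cst w = q)" for q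
  have rep: "rep (cst w) \<in> lists \<Sigma> \<and> st (rep (cst w)) = st w" if "w \<in> lists \<Sigma>" for w
  proof -
    have "rep (cst w) \<in> lists \<Sigma> \<and> cst (rep (cst w)) = cst w"
      unfolding rep_def by (rule someI[of _ w]) (use that in auto)
    thus ?thesis using code that unfolding cst_def by (auto dest: inj_onD)
  qed
  define M where "M = \<lparr>dfa_states = cst ` lists \<Sigma>, dfa_init = cst [],
     dfa_final = cst ` {w \<in> lists \<Sigma>. F (st w)}, dfa_next = \<lambda>q a. cst (rep q @ [a])\<rparr>"
  have run: "foldl (dfa_next M) (dfa_init M) w = cst w" if "w \<in> lists \<Sigma>" for w
    using that
  proof (induction w rule: rev_induct)
    case (snoc a w)
    hence w: "w \<in> lists \<Sigma>" "a \<in> \<Sigma>" by auto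
    hence "st (rep (cst w) @ [a]) = st (w @ [a])" using rep[OF w(1)] by (intro step) auto
    thus ?case using snoc w by (simp add: M_def cst_def)
  qed (simp add: M_def)
  have "finite (dfa_states M)" using fin by (simp add: M_def cst_def flip: image_image)
  hence "dfa_over \<Sigma> M"
    using rep by (auto simp: dfa_over_def M_def)
  moreover have "K = dfa_language \<Sigma> M"
  proof (rule Set.set_eqI)
    fix w
    show "w \<in> K \<longleftrightarrow> w \<in> dfa_language \<Sigma> M"
    proof (cases "w \<in> lists \<Sigma>")
      case True
      have "cst w \<in> dfa_final M \<longleftrightarrow> F (st w)"
      proof
        assume "cst w \<in> dfa_final M"
        then obtain v where v: "v \<in> lists \<Sigma>" "F (st v)" "code (st w) = code (st v)"
          by (auto simp: M_def cst_def)
        hence "st w = st v" using code True by (auto dest: inj_onD)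
        thus "F (st w)" using v by simp
      qed (use True in \<open>auto simp: M_def\<close>)
      thus ?thesis using True final run by (auto simp: dfa_language_def)
    qed (use K in \<open>auto simp: dfa_language_def\<close>)
  qed
  ultimately show ?thesis by (auto simp: regular_language_def)
qed

text \<open>The two words written on a pair of tapes, with the padding dropped. They also make sense for words
that are not convolutions, which is needed to recognise the convolutions among all words.\<close>

definition track1 :: "('a option \<times> 'a option) list \<Rightarrow> 'a list" where
  "track1 w = List.map_filter fst w"
definition track2 :: "('a option \<times> 'a option) list \<Rightarrow> 'a list" where
  "track2 w = List.map_filter snd w"

lemma track_simps [simp]:
  "track1 [] = []" "track2 [] = []"
  "track1 (c # w) = (case fst c of None \<Rightarrow> track1 w | Some a \<Rightarrow> a # track1 w)"
  "track2 (c # w) = (case snd c of None \<Rightarrow> track2 w | Some a \<Rightarrow> a # track2 w)"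
  by (auto simp: track1_def track2_def List.map_filter_def split: option.splits)

lemma track_append [simp]:
  "track1 (u @ v) = track1 u @ track1 v" "track2 (u @ v) = track2 u @ track2 v"
  by (induction u) (auto split: option.splits)

lemma length_track: "length (track1 w) \<le> length w" "length (track2 w) \<le> length w"
  by (induction w) (auto split: option.splits)

lemma track_take_convolution [simp]:
  "track1 (take t (convolution u v)) = take t u" "track2 (take t (convolution u v)) = take t v"
  by (induction u v arbitrary: t rule: convolution.induct; case_tac t; simp)+

lemma track_convolution [simp]:
  "track1 (convolution u v) = u" "track2 (convolution u v) = v"
  by (induction u v rule: convolution.induct) auto

lemma length_convolution [simp]: "length (convolution u v) = max (length u) (length v)"
  by (induction u v rule: convolution.induct) auto

lemma drop_convolution:
  "\<forall>c \<in> set (drop (length u) (convolution u v)). fst c = None"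
  by (induction u v rule: convolution.induct) auto

section \<open>Separation from loops that need long fillings\<close>

text \<open>
  As short loops act trivially, the action of a word of length less than \<open>k / 2\<close> depends on its value
  only, and the action extends to short group elements. The generators act by
  arbitrary maps; that they are bijections follows from \<open>k > 2\<close>, because \<open>s\<close> followed by its inverse is
  a short loop.
\<close>

locale short_words_act = group G for G (structure) +
  fixes A :: "'a set" and act :: "'x \<Rightarrow> 'a \<Rightarrow> 'x" and k :: nat
  assumes A: "A \<subseteq> carrier G" and k: "k > 2"
    and short: "w \<in> lists (sym_gens G A) \<Longrightarrow> length w < k \<Longrightarrow> word_prod G w = \<one> \<Longrightarrow> foldl act x w = x"
begin

abbreviation "S \<equiv> sym_gens G A"

lemma undo: "u \<in> lists S \<Longrightarrow> foldl act x (u @ inv_word u) = x"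
proof (induction u arbitrary: x)
  case (Cons s u)
  hence s: "s \<in> S" "inv s \<in> S" "s \<in> carrier G"
    using sym_gens_inv[OF A] sym_gens_closed[OF A] by auto
  hence "foldl act x [s, inv s] = x" using k by (intro short) auto
  thus ?case using Cons by (simp add: inv_word_Cons)
qed simp

lemma short_eq:
  assumes u: "u \<in> lists S" and v: "v \<in> lists S" and len: "length u + length v < k"
    and eq: "word_prod G u = word_prod G v"
  shows "foldl act x u = foldl act x v"
proof -
  note cl = gens_words_closed[OF A u] gens_words_closed[OF A v]
  have "word_prod G (inv_word u @ v) = \<one>"
    using cl eq word_prod_inv_word[OF cl(1)] by simp
  hence "foldl act (foldl act x u) (inv_word u @ v) = foldl act x u"
    using assms inv_word_gens[OF A] by (intro short) auto
  moreover have "foldl act (foldl act x u) (inv_word u) = x"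
    using undo[OF u, of x] by simp
  ultimately show ?thesis by simp
qed

text \<open>
  A word \<open>z\<close> that connects the two paths at one time and a word \<open>z'\<close> that connects them at the next
  form, together with the steps of both paths, a loop of length at most \<open>2 D + 2 c\<close>. This loop is short, so the connection in the group is also one for the action.
\<close>

lemma fellow_travellers_lift:
  fixes \<omega> :: "'l \<Rightarrow> 'a list"
  defines "W \<equiv> \<lambda>u. concat (map \<omega> u)"
  assumes \<omega>: "\<And>\<sigma>. \<sigma> \<in> \<Sigma> \<Longrightarrow> \<omega> \<sigma> \<in> lists S \<and> length (\<omega> \<sigma>) \<le> c"
    and u: "u \<in> lists \<Sigma>" and v: "v \<in> lists \<Sigma>"
    and close: "\<And>t. \<exists>z \<in> lists S. length z \<le> D \<and> word_prod G (W (take t u) @ z) = word_prod G (W (take t v))"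
    and small: "2 * D + 2 * c < k"
  shows "\<exists>z \<in> lists S. length z \<le> D \<and> word_prod G (W (take t u) @ z) = word_prod G (W (take t v)) \<and>
    foldl act x (W (take t u) @ z) = foldl act x (W (take t v))"
proof (induction t)
  case 0
  show ?case by (rule bexI[of _ "[]"]) (auto simp: W_def)
next
  case (Suc t)
  have W: "W u \<in> lists S" if "u \<in> lists \<Sigma>" for u
    using that \<omega> by (induction u) (auto simp: W_def simp del: in_lists_conv_set)
  have step: "\<exists>p \<in> lists S. length p \<le> c \<and> W (take (Suc t) u) = W (take t u) @ p" if "u \<in> lists \<Sigma>" for u
  proof (cases "t < length u")
    case True
    hence "u ! t \<in> \<Sigma>" using that by auto
    thus ?thesis using \<omega> True by (intro bexI[of _ "\<omega> (u ! t)"]) (auto simp: W_def take_Suc_conv_app_nth)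
  qed (auto intro!: bexI[of _ "[]"])
  have in\<Sigma>: "take n u \<in> lists \<Sigma>" "take n v \<in> lists \<Sigma>" for n
    using u v by (auto dest: in_set_takeD)
  obtain z where z: "z \<in> lists S" "length z \<le> D"
    "word_prod G (W (take t u) @ z) = word_prod G (W (take t v))"
    "foldl act x (W (take t u) @ z) = foldl act x (W (take t v))" using Suc.IH by blast
  obtain z' where z': "z' \<in> lists S" "length z' \<le> D"
    "word_prod G (W (take (Suc t) u) @ z') = word_prod G (W (take (Suc t) v))" using close by blast
  obtain p where p: "p \<in> lists S" "length p \<le> c" "W (take (Suc t) u) = W (take t u) @ p" using step[OF u] by blast
  obtain q where q: "q \<in> lists S" "length q \<le> c" "W (take (Suc t) v) = W (take t v) @ q" using step[OF v] by blast
  note cl = gens_words_closed[OF A]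
  note cls = cl[OF W[OF in\<Sigma>(1)[of t]]] cl[OF W[OF in\<Sigma>(2)[of t]]] cl[OF p(1)] cl[OF q(1)] cl[OF z(1)] cl[OF z'(1)]
  have "word_prod G (W (take t u)) \<otimes> word_prod G (p @ z') = word_prod G (W (take t u)) \<otimes> word_prod G (z @ q)"
    using z(3) z'(3) cls by (simp add: p(3) q(3) m_assoc[symmetric] del: in_lists_conv_set)
  hence "word_prod G (p @ z') = word_prod G (z @ q)"
    using cls by (simp del: in_lists_conv_set)
  hence "foldl act (foldl act x (W (take t u))) (p @ z') = foldl act (foldl act x (W (take t u))) (z @ q)"
    using p q z z' small by (intro short_eq) auto
  thus ?case using z z' p q by (intro bexI[of _ z']) auto
qed

end

text \<open>The two consequences of automaticity that the argument uses. If \<open>v\<close> is longer than \<open>u\<close>, then replacing the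
part of \<open>v\<close> beyond the end of \<open>u\<close> by a short continuation keeps \<open>u\<close> and hence \<open>\<psi> v\<close>; as \<open>\<psi>\<close> is
injective, it keeps \<open>v\<close>, and that part was short. In the same way, a pair of prefixes has a
continuation of bounded length to a pair of neighbours.\<close>

lemma (in group) automatic_rep_lengths:
  assumes rep: "cayley_automatic_rep G A \<Sigma> L \<psi>" and A: "finite A" "A \<subseteq> carrier G"
  obtains C where
    "\<And>s u v. s \<in> sym_gens G A \<Longrightarrow> u \<in> L \<Longrightarrow> v \<in> L \<Longrightarrow> \<psi> u \<otimes> s = \<psi> v \<Longrightarrow> length v \<le> length u + C"
    "\<And>s u v t. s \<in> sym_gens G A \<Longrightarrow> u \<in> L \<Longrightarrow> v \<in> L \<Longrightarrow> \<psi> u \<otimes> s = \<psi> v \<Longrightarrow>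
       \<exists>y1 \<in> lists \<Sigma>. \<exists>y2 \<in> lists \<Sigma>. length y1 \<le> C \<and> length y2 \<le> C \<and>
         take t u @ y1 \<in> L \<and> take t v @ y2 \<in> L \<and> \<psi> (take t u @ y1) \<otimes> s = \<psi> (take t v @ y2)"
proof -
  have L: "L \<subseteq> lists \<Sigma>" and inj: "inj_on \<psi> L" using rep
    by (auto simp: cayley_automatic_rep_def bij_betw_def)
  let ?P = "\<lambda>C s. \<forall>u \<in> L. \<forall>v \<in> L. \<psi> u \<otimes> s = \<psi> v \<longrightarrow>
    length v \<le> length u + C \<and>
    (\<forall>t. \<exists>y1 \<in> lists \<Sigma>. \<exists>y2 \<in> lists \<Sigma>. length y1 \<le> C \<and> length y2 \<le> C \<and>
       take t u @ y1 \<in> L \<and> take t v @ y2 \<in> L \<and> \<psi> (take t u @ y1) \<otimes> s = \<psi> (take t v @ y2))"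
  have one: "\<exists>C. ?P C s" if s: "s \<in> sym_gens G A" for s
  proof -
    define R where "R = {(u, v) \<in> L \<times> L. \<psi> u \<otimes> s = \<psi> v}"
    define K where "K = (\<lambda>(u, v). convolution u v) ` R"
    have "sync_recognizable \<Sigma> R" using rep s by (simp add: cayley_automatic_rep_def R_def)
    hence reg: "regular_language (padded_pairs \<Sigma>) K" by (simp add: sync_recognizable_def K_def)
    have K: "(track1 w, track2 w) \<in> R" "w = convolution (track1 w) (track2 w)" if "w \<in> K" for w
      using that by (auto simp: K_def)
    obtain C1 where C1: "\<And>x y. x @ y \<in> K \<Longrightarrow> \<exists>y'. x @ y' \<in> K \<and> length y' \<le> C1"
      using short_continuation[OF reg, of "\<lambda>_. True"] by auto
    obtain C2 where C2: "\<And>x y. x @ y \<in> K \<Longrightarrow> (\<forall>c \<in> set y. fst c = None) \<Longrightarrow>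
        \<exists>y'. x @ y' \<in> K \<and> (\<forall>c \<in> set y'. fst c = None) \<and> length y' \<le> C2"
      using short_continuation[OF reg, of "\<lambda>y. \<forall>c \<in> set y. fst c = None"] by auto
    have "?P (max C1 C2) s"
    proof (intro ballI impI conjI allI)
      fix u v assume uv: "u \<in> L" "v \<in> L" "\<psi> u \<otimes> s = \<psi> v"
      hence mem: "convolution u v \<in> K" by (auto simp: K_def R_def)
      have "take (length u) (convolution u v) @ drop (length u) (convolution u v) \<in> K"
        using mem by simp
      then obtain y where y: "take (length u) (convolution u v) @ y \<in> K"
        "\<forall>c \<in> set y. fst c = None" "length y \<le> C2"
        using C2 drop_convolution by blast
      have "track1 y = []" using y(2) by (induction y) auto
      hence "(u, take (length u) v @ track2 y) \<in> R" using K(1)[OF y(1)] by simp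
      hence "take (length u) v @ track2 y = v"
        using uv inj by (auto simp: R_def inj_on_def)
      hence "length v = min (length v) (length u) + length (track2 y)"
        by (metis length_append length_take)
      thus "length v \<le> length u + max C1 C2"
        using y(3) length_track(2)[of y] by linarith
    next
      fix u v t assume uv: "u \<in> L" "v \<in> L" "\<psi> u \<otimes> s = \<psi> v"
      hence mem: "take t (convolution u v) @ drop t (convolution u v) \<in> K" by (auto simp: K_def R_def)
      then obtain y where y: "take t (convolution u v) @ y \<in> K" "length y \<le> C1" using C1 by blast
      have R: "(take t u @ track1 y, take t v @ track2 y) \<in> R" using K(1)[OF y(1)] by simp
      hence "track1 y \<in> lists \<Sigma>" "track2 y \<in> lists \<Sigma>" using L by (force simp: R_def)+
      thus "\<exists>y1 \<in> lists \<Sigma>. \<exists>y2 \<in> lists \<Sigma>. length y1 \<le> max C1 C2 \<and> length y2 \<le> max C1 C2 \<and>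
         take t u @ y1 \<in> L \<and> take t v @ y2 \<in> L \<and> \<psi> (take t u @ y1) \<otimes> s = \<psi> (take t v @ y2)"
        using R y(2) length_track[of y]
        by (intro bexI[of _ "track1 y"] bexI[of _ "track2 y"]) (auto simp: R_def)
    qed
    thus ?thesis by blast
  qed
  then obtain C where C: "\<And>s. s \<in> sym_gens G A \<Longrightarrow> ?P (C s) s" by metis
  have "finite (sym_gens G A)" using A by (simp add: sym_gens_def)
  then obtain B where B: "\<forall>s \<in> sym_gens G A. C s \<le> B"
    using finite_nat_set_iff_bounded_le[of "C ` sym_gens G A"] by auto
  show thesis
  proof (rule that[of B], goal_cases)
    case (1 s u v)
    thus ?case using C[of s] B by fastforce
  next
    case (2 s u v t)
    then obtain y1 y2 where "y1 \<in> lists \<Sigma>" "y2 \<in> lists \<Sigma>" "length y1 \<le> C s" "length y2 \<le> C s"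
      "take t u @ y1 \<in> L" "take t v @ y2 \<in> L" "\<psi> (take t u @ y1) \<otimes> s = \<psi> (take t v @ y2)"
      using C[of s] by meson
    thus ?case using B 2(1) by (meson order_trans)
  qed
qed

text \<open>The lift \<open>\<Psi>\<close> is only compatible with the generators on words up to length \<open>n\<close>, so the lengths of the words
for the vertices of the path \<open>r\<close> have to be controlled on the way.\<close>

lemma (in group) words_along_path:
  assumes surj: "\<psi> ` L = carrier G" and A: "A \<subseteq> carrier G"
    and len: "\<And>s u v. s \<in> sym_gens G A \<Longrightarrow> u \<in> L \<Longrightarrow> v \<in> L \<Longrightarrow> \<psi> u \<otimes> s = \<psi> v \<Longrightarrow> length v \<le> length u + C"
    and lift: "\<And>s u v. s \<in> sym_gens G A \<Longrightarrow> u \<in> L \<Longrightarrow> v \<in> L \<Longrightarrow> \<psi> u \<otimes> s = \<psi> v \<Longrightarrow>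
         length u \<le> n \<Longrightarrow> length v \<le> n \<Longrightarrow> act (\<Psi> u) s = \<Psi> v"
    and u: "u \<in> L" and r: "r \<in> lists (sym_gens G A)" and n: "length u + C * length r \<le> n"
  shows "\<exists>v \<in> L. \<psi> v = \<psi> u \<otimes> word_prod G r \<and> foldl act (\<Psi> u) r = \<Psi> v"
  using u r n
proof (induction r arbitrary: u)
  case Nil
  have "\<psi> u \<in> carrier G" using surj Nil by auto
  thus ?case using Nil by (intro bexI[of _ u]) auto
next
  case (Cons s r)
  hence s: "s \<in> sym_gens G A" "s \<in> carrier G" and r: "r \<in> lists (sym_gens G A)"
    using sym_gens_closed[OF A] by auto
  have u: "\<psi> u \<in> carrier G" using surj Cons by auto
  hence "\<psi> u \<otimes> s \<in> \<psi> ` L" using s surj by simp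
  then obtain v where v: "v \<in> L" "\<psi> u \<otimes> s = \<psi> v" by auto
  have lv: "length v \<le> length u + C" using len s Cons v by blast
  hence "length v + C * length r \<le> n" using Cons.prems(3) by simp
  from Cons.IH[OF v(1) r this] obtain v' where
    v': "v' \<in> L" "\<psi> v' = \<psi> v \<otimes> word_prod G r" "foldl act (\<Psi> v) r = \<Psi> v'" by blast
  have "act (\<Psi> u) s = \<Psi> v" using lift[OF s(1) Cons.prems(1) v] lv Cons.prems(3) by simp
  moreover have "\<psi> v' = \<psi> u \<otimes> word_prod G (s # r)"
    using v' u s gens_words_closed[OF A r] by (simp add: m_assoc v(2)[symmetric] del: in_lists_conv_set)
  ultimately show ?case using v' by auto
qed

text \<open>If \<open>n\<close> were larger than \<open>4 b + E\<close>, take the action for which loops shorter than \<open>n\<close> are trivial. Every \<open>w\<close> in \<open>L\<close> gives a point \<open>\<Psi> w\<close> of the set acted on: walk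
along \<open>w\<close> through \<open>\<alpha>\<close> and then at most \<open>b\<close> steps to \<open>\<psi> w\<close>. Fellow travelling makes \<open>\<Psi>\<close> compatible with the
generators, so a loop in the group returns \<open>\<Psi>\<close> to its value and cannot act nontrivially on it.\<close>

lemma (in group) distance_grows:
  fixes \<alpha> :: "nat \<Rightarrow> 'a"
  assumes fg: "finite_generating_set G A"
    and act: "\<And>k. \<exists>act :: 'x \<Rightarrow> 'a \<Rightarrow> 'x.
      (\<forall>w \<in> lists (sym_gens G A). length w < k \<longrightarrow> word_prod G w = \<one> \<longrightarrow> (\<forall>x. foldl act x w = x)) \<and>
      (\<exists>r \<in> lists (sym_gens G A). length r \<le> c * k + c \<and> word_prod G r = \<one> \<and> (\<exists>x. foldl act x r \<noteq> x))"
    and rep: "cayley_automatic_rep G A \<Sigma> L \<psi>" and \<alpha>: "\<alpha> \<in> \<Sigma> \<rightarrow> carrier G"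
  shows "\<exists>M E. M > 0 \<and> (\<forall>n b. (\<forall>w \<in> L. length w \<le> M * n \<longrightarrow>
    word_dist G A (word_prod G (map \<alpha> w)) (\<psi> w) \<le> b) \<longrightarrow> n \<le> 4 * b + E)"
proof -
  define S where "S = sym_gens G A"
  have gA: "finite A" "A \<subseteq> carrier G" and gen: "generate G A = carrier G"
    using fg by (auto simp: finite_generating_set_def)
  have fin\<Sigma>: "finite \<Sigma>" and L: "L \<subseteq> lists \<Sigma>" and bij: "bij_betw \<psi> L (carrier G)"
    using rep by (auto simp: cayley_automatic_rep_def)
  have surj: "\<psi> ` L = carrier G" and inj: "inj_on \<psi> L" using bij by (auto simp: bij_betw_def)
  have \<psi>: "\<psi> w \<in> carrier G" if "w \<in> L" for w using that surj by blast
  note cl = gens_words_closed[OF gA(2), folded S_def]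
  obtain C where C1: "\<And>s u v. s \<in> S \<Longrightarrow> u \<in> L \<Longrightarrow> v \<in> L \<Longrightarrow> \<psi> u \<otimes> s = \<psi> v \<Longrightarrow> length v \<le> length u + C"
    and C2: "\<And>s u v t. s \<in> S \<Longrightarrow> u \<in> L \<Longrightarrow> v \<in> L \<Longrightarrow> \<psi> u \<otimes> s = \<psi> v \<Longrightarrow>
       \<exists>y1 \<in> lists \<Sigma>. \<exists>y2 \<in> lists \<Sigma>. length y1 \<le> C \<and> length y2 \<le> C \<and>
       take t u @ y1 \<in> L \<and> take t v @ y2 \<in> L \<and> \<psi> (take t u @ y1) \<otimes> s = \<psi> (take t v @ y2)"
    by (rule automatic_rep_lengths[OF rep gA, folded S_def]) (rule that; assumption)
  have "\<exists>w \<in> lists S. word_prod G w = \<alpha> \<sigma>" if "\<sigma> \<in> \<Sigma>" for \<sigma>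
    using generate_as_word[OF gA(2), of "\<alpha> \<sigma>"] gen \<alpha> that unfolding S_def by auto
  then obtain \<omega> where \<omega>: "\<And>\<sigma>. \<sigma> \<in> \<Sigma> \<Longrightarrow> \<omega> \<sigma> \<in> lists S" "\<And>\<sigma>. \<sigma> \<in> \<Sigma> \<Longrightarrow> word_prod G (\<omega> \<sigma>) = \<alpha> \<sigma>"
    by metis
  obtain ca where ca: "\<And>\<sigma>. \<sigma> \<in> \<Sigma> \<Longrightarrow> length (\<omega> \<sigma>) \<le> ca"
    using finite_nat_set_iff_bounded_le[of "(\<lambda>\<sigma>. length (\<omega> \<sigma>)) ` \<Sigma>"] fin\<Sigma> by auto
  define W where "W = (\<lambda>u. concat (map \<omega> u))"
  have W: "W u \<in> lists S" "word_prod G (W u) = word_prod G (map \<alpha> u)" "length (W u) \<le> ca * length u"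
    if "u \<in> lists \<Sigma>" for u
  proof -
    have "W u \<in> lists S \<and> word_prod G (W u) = word_prod G (map \<alpha> u) \<and> length (W u) \<le> ca * length u"
      using that
    proof (induction u)
      case (Cons \<sigma> u)
      hence \<sigma>: "\<sigma> \<in> \<Sigma>" and IH: "W u \<in> lists S" "word_prod G (W u) = word_prod G (map \<alpha> u)"
        "length (W u) \<le> ca * length u" by auto
      have "W (\<sigma> # u) = \<omega> \<sigma> @ W u" by (simp add: W_def)
      thus ?case using IH \<omega>[OF \<sigma>] ca[OF \<sigma>] cl[OF \<omega>(1)[OF \<sigma>]] cl[OF IH(1)]
        by (simp del: in_lists_conv_set)
    qed (auto simp: W_def)
    thus "W u \<in> lists S" "word_prod G (W u) = word_prod G (map \<alpha> u)" "length (W u) \<le> ca * length u"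
      by auto
  qed
  have W_eq: "concat (map \<omega> u) = W u" for u by (simp add: W_def)
  have W_append: "W (u @ v) = W u @ W v" for u v by (simp add: W_def)
  have "\<exists>xs \<in> lists S. length xs = word_dist G A (word_prod G (map \<alpha> w)) (\<psi> w) \<and>
      word_prod G (W w) \<otimes> word_prod G xs = \<psi> w" if "w \<in> L" for w
  proof -
    have w: "w \<in> lists \<Sigma>" using that L by auto
    have "word_prod G (map \<alpha> w) \<in> carrier G"
      using cl[OF W(1)[OF w]] W(2)[OF w] word_prod_closed by metis
    from word_dist_witness[OF fg this \<psi>[OF that]]
    show ?thesis using W(2)[OF w] unfolding S_def by simp
  qed
  then obtain X where X: "\<And>w. w \<in> L \<Longrightarrow> X w \<in> lists S"
    "\<And>w. w \<in> L \<Longrightarrow> length (X w) = word_dist G A (word_prod G (map \<alpha> w)) (\<psi> w)"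
    "\<And>w. w \<in> L \<Longrightarrow> word_prod G (W w) \<otimes> word_prod G (X w) = \<psi> w" by metis
  obtain u0 where u0: "u0 \<in> L" using surj by fastforce
  define m where "m = length u0 + C * (2 * c)"
  define M where "M = m + C + 1"
  \<comment> \<open>The constant collects what \<open>2 * D + 2 * ca\<close> and \<open>2 * b + 1 + D\<close> contain besides \<open>4 * b\<close>, and makes \<open>n > 2\<close>.\<close>
  define E where "E = 4 * C * ca + 2 * ca + 5"
  have "n \<le> 4 * b + E" if b: "\<forall>w \<in> L. length w \<le> M * n \<longrightarrow>
    word_dist G A (word_prod G (map \<alpha> w)) (\<psi> w) \<le> b" for n b
  proof (rule ccontr)
    assume "\<not> n \<le> 4 * b + E"
    hence n: "n > 4 * b + E" by simp
    have Xb: "length (X w) \<le> b" if "w \<in> L" "length w \<le> M * n" for w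
      using b X(2) that by simp
    obtain act :: "'x \<Rightarrow> 'a \<Rightarrow> 'x" and r x where
      short: "\<And>w x. w \<in> lists S \<Longrightarrow> length w < n \<Longrightarrow> word_prod G w = \<one> \<Longrightarrow> foldl act x w = x"
      and r: "r \<in> lists S" "length r \<le> c * n + c" "word_prod G r = \<one>" "foldl act x r \<noteq> x"
      using act[of n] unfolding S_def by blast
    interpret short_words_act G A act n
      using gA short n by unfold_locales (auto simp: S_def E_def)
    define D where "D = 2 * C * ca + 2 * b + 1"
    have small: "2 * D + 2 * ca < n" "2 * b + 1 + D < n"
      using n by (auto simp: D_def E_def)
    \<comment> \<open>The base point is chosen such that the walk to the vertex of \<open>u0\<close>, where the loop is read, ends at \<open>x\<close>.\<close>
    define y where "y = foldl act x (inv_word (W u0 @ X u0))"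
    define \<Psi> where "\<Psi> w = foldl act y (W w @ X w)" for w
    have lift: "act (\<Psi> u) s = \<Psi> v"
      if s: "s \<in> S" and uv: "u \<in> L" "v \<in> L" "\<psi> u \<otimes> s = \<psi> v" and len: "length u \<le> m * n" "length v \<le> m * n"
      for s u v
    proof -
      have u\<Sigma>: "u \<in> lists \<Sigma>" and v\<Sigma>: "v \<in> lists \<Sigma>" using uv L by auto
      have sG: "s \<in> carrier G" using s sym_gens_closed[OF gA(2)] unfolding S_def by auto
      have long: "k \<le> m * n + C \<Longrightarrow> k \<le> M * n" for k
        using n by (cases n) (auto simp: M_def algebra_simps)
      \<comment> \<open>The connecting word goes along the completion of the prefix of \<open>u\<close>, over to the represented element,
         along \<open>s\<close>, and back in the same way on the side of \<open>v\<close>.\<close>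
      have close: "\<exists>z \<in> lists S. length z \<le> D \<and> word_prod G (W (take t u) @ z) = word_prod G (W (take t v))" for t
      proof -
        obtain y1 y2 where y: "y1 \<in> lists \<Sigma>" "y2 \<in> lists \<Sigma>" "length y1 \<le> C" "length y2 \<le> C"
          "take t u @ y1 \<in> L" "take t v @ y2 \<in> L" "\<psi> (take t u @ y1) \<otimes> s = \<psi> (take t v @ y2)"
          using C2[OF s uv] by blast
        let ?u = "take t u @ y1" and ?v = "take t v @ y2"
        have t\<Sigma>: "take t u \<in> lists \<Sigma>" "take t v \<in> lists \<Sigma>"
          using u\<Sigma> v\<Sigma> by (auto dest: in_set_takeD)
        note mem = W(1)[OF t\<Sigma>(1)] W(1)[OF t\<Sigma>(2)] W(1)[OF y(1)] W(1)[OF y(2)] X(1)[OF y(5)] X(1)[OF y(6)]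
        note cls = cl[OF mem(1)] cl[OF mem(2)] cl[OF mem(3)] cl[OF mem(4)] cl[OF mem(5)] cl[OF mem(6)]
        define p q where "p = W y1 @ X ?u" and "q = W y2 @ X ?v"
        have pq: "p \<in> lists S" "q \<in> lists S" using mem by (auto simp: p_def q_def)
        have p: "word_prod G (W (take t u)) \<otimes> word_prod G p = \<psi> ?u"
          and q: "word_prod G (W (take t v)) \<otimes> word_prod G q = \<psi> ?v"
          using X(3)[OF y(5)] X(3)[OF y(6)] cls
          by (simp_all add: p_def q_def W_append m_assoc del: in_lists_conv_set)
        have "ca * length y1 \<le> C * ca" "ca * length y2 \<le> C * ca" using y(3,4) by (simp_all add: mult.commute)
        moreover have "length ?u \<le> M * n" "length ?v \<le> M * n"
          using len y(3,4) by (auto intro!: long)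
        ultimately have lpq: "length p \<le> C * ca + b" "length q \<le> C * ca + b"
          using W(3)[OF y(1)] W(3)[OF y(2)] Xb[OF y(5)] Xb[OF y(6)] unfolding p_def q_def length_append
          by linarith+
        note ppq = cl[OF pq(1)] cl[OF pq(2)]
        have "word_prod G (W (take t u) @ (p @ [s] @ inv_word q)) =
           \<psi> ?u \<otimes> s \<otimes> inv (word_prod G q)"
          using word_prod_inv_word[OF ppq(2)] cls(1) ppq sG
          by (simp add: m_assoc p[symmetric] del: in_lists_conv_set)
        also have "\<dots> = word_prod G (W (take t v))"
          using cls(2) ppq by (simp add: y(7) q[symmetric] m_assoc del: in_lists_conv_set)
        finally show ?thesis using lpq pq s inv_word_gens[OF gA(2), folded S_def, OF pq(2)]
          by (intro bexI[of _ "p @ [s] @ inv_word q"]) (auto simp: D_def)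
      qed
      obtain z where z: "z \<in> lists S" "length z \<le> D" "word_prod G (W u @ z) = word_prod G (W v)"
          "foldl act y (W u @ z) = foldl act y (W v)"
        using fellow_travellers_lift[where \<Sigma> = \<Sigma> and \<omega> = \<omega> and c = ca and u = u and v = v
            and D = D and x = y and t = "max (length u) (length v)", folded S_def, unfolded W_eq]
          close \<omega>(1) ca small(1) u\<Sigma> v\<Sigma> by auto
      note mem = W(1)[OF u\<Sigma>] W(1)[OF v\<Sigma>] X(1)[OF uv(1)] X(1)[OF uv(2)]
      note cls = cl[OF mem(1)] cl[OF mem(2)] cl[OF mem(3)] cl[OF mem(4)] cl[OF z(1)]
      have "word_prod G (W u) \<otimes> word_prod G (X u @ [s]) = \<psi> u \<otimes> s"
        using cls sG by (simp add: X(3)[OF uv(1), symmetric] m_assoc del: in_lists_conv_set)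
      also have "\<dots> = word_prod G (W u) \<otimes> word_prod G (z @ X v)"
        using cls z(3) by (simp add: uv(3) X(3)[OF uv(2), symmetric] m_assoc[symmetric] del: in_lists_conv_set)
      finally have "word_prod G (X u @ [s]) = word_prod G (z @ X v)"
        using cls sG by (simp del: in_lists_conv_set)
      moreover have "length (X u) \<le> b" "length (X v) \<le> b"
        using Xb[OF uv(1) long] Xb[OF uv(2) long] len by auto
      ultimately have "foldl act (foldl act y (W u)) (X u @ [s]) = foldl act (foldl act y (W u)) (z @ X v)"
        using z mem s small by (intro short_eq[folded S_def]) auto
      thus ?thesis using z(4) by (simp add: \<Psi>_def)
    qed
    have "c * n + c \<le> 2 * c * n" using n by (cases n) auto
    hence "length r \<le> 2 * c * n" using r(2) by linarith
    hence "C * length r \<le> C * (2 * c * n)" by simp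
    moreover have "length u0 \<le> length u0 * n" using n by simp
    ultimately have "length u0 + C * length r \<le> length u0 * n + C * (2 * c * n)" by linarith
    hence bound: "length u0 + C * length r \<le> m * n" by (simp add: m_def algebra_simps)
    have "\<exists>v \<in> L. \<psi> v = \<psi> u0 \<otimes> word_prod G r \<and> foldl act (\<Psi> u0) r = \<Psi> v"
      by (rule words_along_path[where A = A and C = C and n = "m * n" and \<psi> = \<psi> and L = L
          and \<Psi> = \<Psi> and act = act, folded S_def,
          OF surj gA(2) C1 lift u0 r(1) bound])
    then obtain v where v: "v \<in> L" "\<psi> v = \<psi> u0 \<otimes> word_prod G r" "foldl act (\<Psi> u0) r = \<Psi> v"
      by (elim bexE conjE)
    hence "v = u0" using inj u0 \<psi>[OF u0] r(3) by (auto dest: inj_onD)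
    moreover have "\<Psi> u0 = x"
    proof -
      have mem: "W u0 @ X u0 \<in> lists S" using W(1) X(1)[OF u0] u0 L by auto
      have "foldl act y (W u0 @ X u0) = foldl act x (inv_word (W u0 @ X u0) @ inv_word (inv_word (W u0 @ X u0)))"
      proof -
        have "inv_word (inv_word (W u0 @ X u0)) = W u0 @ X u0"
          using cl[OF mem] by (auto simp: inv_word_def rev_map[symmetric] intro!: map_idI)
        thus ?thesis by (simp add: y_def)
      qed
      also have "\<dots> = x"
        by (rule undo) (rule inv_word_gens[OF gA(2) mem[unfolded S_def]])
      finally show ?thesis by (simp add: \<Psi>_def)
    qed
    ultimately show False using v(3) r(4) by simp
  qed
  thus ?thesis by (intro exI[of _ M] exI[of _ E]) (auto simp: M_def)
qed

text \<open>Groups with such actions are not finitely presented; the linear bound on the length of the loop that acts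
nontrivially makes the identity function a lower bound.\<close>

theorem (in group) separated_from_automaticI:
  assumes fg: "finite_generating_set G A"
    and act: "\<And>k. \<exists>act :: 'x \<Rightarrow> 'a \<Rightarrow> 'x.
      (\<forall>w \<in> lists (sym_gens G A). length w < k \<longrightarrow> word_prod G w = \<one> \<longrightarrow> (\<forall>x. foldl act x w = x)) \<and>
      (\<exists>r \<in> lists (sym_gens G A). length r \<le> c * k + c \<and> word_prod G r = \<one> \<and> (\<exists>x. foldl act x r \<noteq> x))"
  shows "separated_from_automatic G A"
proof -
  have "dominated 0 real (lang_min_length L) (cayley_distance G A L \<psi> \<alpha>)"
    if rep: "cayley_automatic_rep G A \<Sigma> L \<psi>" and \<alpha>: "\<alpha> \<in> \<Sigma> \<rightarrow> carrier G"
    for \<Sigma> :: "nat set" and L \<psi> \<alpha>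
  proof -
    obtain M E where M: "M > 0" and ME: "\<And>n b. (\<And>w. w \<in> L \<Longrightarrow> length w \<le> M * n \<Longrightarrow>
      word_dist G A (word_prod G (map \<alpha> w)) (\<psi> w) \<le> b) \<Longrightarrow> n \<le> 4 * b + E"
      using distance_grows[OF fg act rep \<alpha>] by blast
    have "real n \<le> real 8 * cayley_distance G A L \<psi> \<alpha> (M * n)" if "n \<ge> 2 * E" "n > 0" for n
    proof -
      let ?h = "cayley_distance G A L \<psi> \<alpha> (M * n)"
      have "n \<le> 4 * nat \<lfloor>?h\<rfloor> + E"
      proof (rule ME)
        fix w assume w: "w \<in> L" "length w \<le> M * n"
        have "real (word_dist G A (word_prod G (map \<alpha> w)) (\<psi> w)) \<le> ?h"
          using rep w by (intro word_dist_le_cayley_distance[of \<Sigma>]) (auto simp: cayley_automatic_rep_def)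
        thus "word_dist G A (word_prod G (map \<alpha> w)) (\<psi> w) \<le> nat \<lfloor>?h\<rfloor>"
          by (simp add: le_nat_floor)
      qed
      hence n: "n \<le> 8 * nat \<lfloor>?h\<rfloor>" using that by linarith
      hence "nat \<lfloor>?h\<rfloor> > 0" using that by linarith
      hence "?h \<ge> 0" by linarith
      hence "real (nat \<lfloor>?h\<rfloor>) \<le> ?h" by (rule of_nat_floor)
      thus ?thesis using n by linarith
    qed
    thus ?thesis unfolding dominated_def using M
      by (intro exI[of _ "8::nat"] exI[of _ M] exI[of _ "max (lang_min_length L) (2 * E + 1)"]) auto
  qed
  moreover have "\<not> bdd_above (real ` {0..})"
  proof
    assume "bdd_above (real ` {0..})"
    then obtain B where "\<And>n. real n \<le> B" by (auto simp: bdd_above_def)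
    thus False using reals_Archimedean2[of B] by (meson not_less)
  qed
  ultimately show ?thesis unfolding separated_from_automatic_def
    by (intro exI[of _ 0] exI[of _ real]) (auto simp: mono_on_def)
qed

section \<open>The lamplighter group\<close>

type_synonym lamps = "int fset \<times> int"

definition shift :: "int \<Rightarrow> int fset \<Rightarrow> int fset" where
  "shift n f = (\<lambda>i. n + i) |`| f"

definition toggle :: "int fset \<Rightarrow> int fset \<Rightarrow> int fset" where
  "toggle f g = (f |-| g) |\<union>| (g |-| f)"

text \<open>The second factor is read from the place where the first one leaves the lamplighter.\<close>

fun lmult :: "lamps \<Rightarrow> lamps \<Rightarrow> lamps" where
  "lmult (f, m) (g, n) = (toggle f (shift m g), m + n)"

lemma fmember_shift [simp]: "i |\<in>| shift n f \<longleftrightarrow> i - n |\<in>| f"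
  by (force simp: shift_def image_iff)

lemma fmember_toggle [simp]: "i |\<in>| toggle f g \<longleftrightarrow> (i |\<in>| f) \<noteq> (i |\<in>| g)"
  by (auto simp: toggle_def)

lemma lmult_assoc: "lmult (lmult x y) z = lmult x (lmult y z)"
  by (cases x; cases y; cases z) (auto simp: fset_eq_iff algebra_simps)

lemma lmult_one: "lmult ({||}, 0) x = x" "lmult x ({||}, 0) = x"
  by (cases x; auto simp: fset_eq_iff)+

definition linv :: "lamps \<Rightarrow> lamps" where
  "linv x = (shift (- snd x) (fst x), - snd x)"

lemma lmult_linv: "lmult (linv x) x = ({||}, 0)"
  by (cases x) (auto simp: fset_eq_iff linv_def)

text \<open>The elements are numbered only to obtain a group of natural numbers. Everything is computed on pairs and
carried over along \<open>code\<close>.\<close>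

definition code :: "lamps \<Rightarrow> nat" where "code = to_nat"
definition uncode :: "nat \<Rightarrow> lamps" where "uncode = from_nat"

lemma uncode_code [simp]: "uncode (code x) = x" by (simp add: code_def uncode_def)
lemma code_eq_iff [simp]: "code x = code y \<longleftrightarrow> x = y" by (simp add: code_def)

definition lamplighter :: "nat monoid" where
  "lamplighter = \<lparr>carrier = range code, mult = \<lambda>x y. code (lmult (uncode x) (uncode y)), one = code ({||}, 0)\<rparr>"

lemma carrier_lamplighter [simp]: "carrier lamplighter = range code"
  and mult_lamplighter [simp]: "code x \<otimes>\<^bsub>lamplighter\<^esub> code y = code (lmult x y)"
  and one_lamplighter: "\<one>\<^bsub>lamplighter\<^esub> = code ({||}, 0)"
  by (simp_all add: lamplighter_def)

interpretation LL: group lamplighter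
proof (rule groupI)
  show "\<exists>y\<in>carrier lamplighter. y \<otimes>\<^bsub>lamplighter\<^esub> x = \<one>\<^bsub>lamplighter\<^esub>" if x: "x \<in> carrier lamplighter" for x
  proof -
    obtain y where "x = code y" using x unfolding carrier_lamplighter by blast
    thus ?thesis by (intro bexI[of _ "code (linv y)"]) (auto simp: one_lamplighter lmult_linv)
  qed
qed (auto simp: one_lamplighter lmult_assoc lmult_one simp del: lmult.simps lists_image)

lemma word_prod_map_code: "word_prod lamplighter (map code ws) = code (foldr lmult ws ({||}, 0))"
  by (induction ws) (auto simp: one_lamplighter)

definition gen_a :: lamps where "gen_a = ({|0|}, 0)"
definition gen_t :: lamps where "gen_t = ({||}, 1)"
definition gen_T :: lamps where "gen_T = ({||}, -1)"

lemma lmult_gens: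
  "lmult (f, n) gen_a = (toggle f {|n|}, n)" "lmult (f, n) gen_t = (f, n + 1)" "lmult (f, n) gen_T = (f, n - 1)"
  by (auto simp: gen_a_def gen_t_def gen_T_def fset_eq_iff)

lemma gens_distinct [simp]: "gen_a \<noteq> gen_t" "gen_t \<noteq> gen_a" "gen_a \<noteq> gen_T" "gen_T \<noteq> gen_a"
  "gen_t \<noteq> gen_T" "gen_T \<noteq> gen_t"
  by (auto simp: gen_a_def gen_t_def gen_T_def)

lemma inv_gens: "inv\<^bsub>lamplighter\<^esub> (code gen_a) = code gen_a" "inv\<^bsub>lamplighter\<^esub> (code gen_t) = code gen_T"
  by (rule LL.inv_equality; simp add: gen_a_def gen_t_def gen_T_def one_lamplighter fset_eq_iff)+

abbreviation lamp_gens :: "nat set" where "lamp_gens \<equiv> {code gen_a, code gen_t}"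

lemma sym_gens_lamplighter:
  "sym_gens lamplighter lamp_gens = {code gen_a, code gen_t, code gen_T}"
  by (auto simp: sym_gens_def inv_gens)

lemma finite_generating_set_lamplighter: "finite_generating_set lamplighter lamp_gens"
proof -
  let ?H = "generate lamplighter lamp_gens"
  have gen: "code gen_a \<in> ?H" "code gen_t \<in> ?H" "code gen_T \<in> ?H"
    using generate.inv[of "code gen_t" lamp_gens lamplighter]
    by (auto simp: inv_gens intro: generate.incl)
  have mult: "code (lmult x y) \<in> ?H" if "code x \<in> ?H" "code y \<in> ?H" for x y
    using generate.eng[OF that] by simp
  have shift: "code ({||}, n) \<in> ?H" for n
  proof (induction n rule: int_induct[of _ 0])
    case base
    show ?case using generate.one[of lamplighter lamp_gens] by (simp add: one_lamplighter)
  next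
    case (step1 i)
    thus ?case using mult[OF _ gen(2), of "({||}, i)"] by (simp add: lmult_gens)
  next
    case (step2 i)
    thus ?case using mult[OF _ gen(3), of "({||}, i)"] by (simp add: lmult_gens)
  qed
  have "code (f, n) \<in> ?H" for f n
  proof (induction f arbitrary: n)
    case empty
    show ?case by (rule shift)
  next
    case (insert i f)
    have "(finsert i f, n) = lmult (lmult (lmult ({||}, i) gen_a) ({||}, - i)) (f, n)"
      using insert.hyps by (auto simp: gen_a_def fset_eq_iff)
    thus ?case using mult gen(1) shift insert.IH by metis
  qed
  hence "range code \<subseteq> ?H" by auto
  moreover have "?H \<subseteq> range code"
    using LL.generate_incl[of lamp_gens] by simp
  ultimately show ?thesis by (auto simp: finite_generating_set_def)
qed

section \<open>Double covers of the lamplighter group\<close>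

text \<open>
  An action of the central extension by a sign: toggling the lamp at \<open>n\<close> changes the sign if the lamp at \<open>n + k\<close> is
  lit. Toggling two lamps in either order gives the same lamps, but the signs differ if the lamps are at
  distance \<open>k\<close>. Lamp sets may be infinite here, because only the lamps near the lamplighter matter.
\<close>

fun cover_act :: "int \<Rightarrow> bool \<times> int set \<times> int \<Rightarrow> nat \<Rightarrow> bool \<times> int set \<times> int" where
  "cover_act k (c, F, n) s =
     (if s = code gen_a then (c \<noteq> (n + k \<in> F), (if n \<in> F then F - {n} else insert n F), n)
      else if s = code gen_t then (c, F, n + 1) else (c, F, n - 1))"

lemma odd_card_toggle:
  "odd (card {i. i |\<in>| toggle f {|m|} \<and> P i}) \<longleftrightarrow> odd (card {i. i |\<in>| f \<and> P i}) \<noteq> P m"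
proof -
  let ?B = "{i. i |\<in>| f \<and> P i}"
  have fin: "finite ?B" by (rule finite_subset[of _ "fset f"]) auto
  show ?thesis
  proof (cases "P m")
    case P: True
    show ?thesis
    proof (cases "m |\<in>| f")
      case True
      have "{i. i |\<in>| toggle f {|m|} \<and> P i} = ?B - {m}" using True by auto
      moreover have "card ?B = Suc (card (?B - {m}))"
        using True P fin by (intro card.remove) auto
      ultimately show ?thesis using P by simp
    next
      case False
      have "{i. i |\<in>| toggle f {|m|} \<and> P i} = insert m ?B" using False P by auto
      thus ?thesis using False P fin by simp
    qed
  next
    case False
    hence "{i. i |\<in>| toggle f {|m|} \<and> P i} = ?B" by auto
    thus ?thesis using False by simp
  qed
qed

text \<open>When a word of length at most \<open>k\<close> toggles a lamp, the lamps that it has toggled before are at distance less than \<open>k\<close>,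
so the lamp that decides about the sign is never one of them. The sign then depends only on which
lamps are toggled an odd number of times, that is, on the value of the word.\<close>

lemma cover_act_short:
  assumes "w \<in> lists {code gen_a, code gen_t, code gen_T}" "int (length w) \<le> k"
  shows "\<exists>f m. word_prod lamplighter w = code (f, m) \<and> (\<forall>i. i |\<in>| f \<longrightarrow> \<bar>m - i\<bar> \<le> length w) \<and>
    foldl (cover_act k) (c, F, n) w =
      (c \<noteq> odd (card {i. i |\<in>| f \<and> n + i + k \<in> F}), {i. (i \<in> F) \<noteq> (i - n |\<in>| f)}, n + m)"
  using assms
proof (induction w rule: rev_induct)
  case Nil
  show ?case by (intro exI[of _ "{||}"] exI[of _ 0]) (auto simp: one_lamplighter)
next
  case (snoc s w)
  then obtain f m where IH: "word_prod lamplighter w = code (f, m)" "\<And>i. i |\<in>| f \<Longrightarrow> \<bar>m - i\<bar> \<le> length w"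
    "foldl (cover_act k) (c, F, n) w =
      (c \<noteq> odd (card {i. i |\<in>| f \<and> n + i + k \<in> F}), {i. (i \<in> F) \<noteq> (i - n |\<in>| f)}, n + m)"
    by auto
  have w: "w \<in> lists (carrier lamplighter)" "s \<in> carrier lamplighter" using snoc.prems by auto
  hence prod: "word_prod lamplighter (w @ [s]) = code (f, m) \<otimes>\<^bsub>lamplighter\<^esub> s"
    by (simp add: IH(1) del: carrier_lamplighter in_lists_conv_set)
  from snoc.prems consider "s = code gen_a" | "s = code gen_t" | "s = code gen_T" by auto
  thus ?case
  proof cases
    case 1
    have nk: "m + k |\<notin>| f" using IH(2)[of "m + k"] snoc.prems(2) by fastforce
    show ?thesis
    proof (intro exI[of _ "toggle f {|m|}"] exI[of _ m] conjI allI impI)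
      show "word_prod lamplighter (w @ [s]) = code (toggle f {|m|}, m)"
        using prod by (simp add: 1 lmult_gens)
      show "\<bar>m - i\<bar> \<le> int (length (w @ [s]))" if "i |\<in>| toggle f {|m|}" for i
        using that IH(2)[of i] by (cases "i = m") auto
      show "foldl (cover_act k) (c, F, n) (w @ [s]) =
         (c \<noteq> odd (card {i. i |\<in>| toggle f {|m|} \<and> n + i + k \<in> F}),
          {i. (i \<in> F) \<noteq> (i - n |\<in>| toggle f {|m|})}, n + m)"
        unfolding odd_card_toggle using nk by (auto simp: IH(3) 1 algebra_simps)
    qed
  next
    case 2
    show ?thesis
      using prod IH(2) by (intro exI[of _ f] exI[of _ "m + 1"]) (force simp: IH(3) 2 lmult_gens)
  next
    case 3
    show ?thesis
      using prod IH(2) by (intro exI[of _ f] exI[of _ "m - 1"]) (force simp: IH(3) 3 lmult_gens)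
  qed
qed

lemma foldl_cover_act_replicate:
  "foldl (cover_act k) (c, F, n) (replicate j (code gen_t)) = (c, F, n + int j)"
  "foldl (cover_act k) (c, F, n) (replicate j (code gen_T)) = (c, F, n - int j)"
  by (induction j arbitrary: n) (auto simp: algebra_simps)

text \<open>The loop that is not seen by short loops is the commutator of the lamps at \<open>0\<close> and \<open>k + 1\<close>. As lamps are involutions,
it is the square \<open>r r\<close> of the word \<open>r\<close> that toggles both and comes back.\<close>

lemma separated_lamplighter: "separated_from_automatic lamplighter lamp_gens"
proof (rule LL.separated_from_automaticI[OF finite_generating_set_lamplighter, where c = 8])
  fix k :: nat
  let ?S = "sym_gens lamplighter lamp_gens" and ?act = "cover_act (int k + 1)"
  define r where "r = [code gen_a] @ replicate (k + 1) (code gen_t) @ [code gen_a] @ replicate (k + 1) (code gen_T)"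
  have r: "r \<in> lists ?S" by (auto simp: r_def sym_gens_lamplighter)
  have rr: "r @ r \<in> lists ?S" "length (r @ r) \<le> 8 * k + 8" using r by (auto simp: r_def)
  have power: "foldr lmult (replicate j gen_t) x = lmult ({||}, int j) x"
    "foldr lmult (replicate j gen_T) x = lmult ({||}, - int j) x" for j x
    by (induction j; cases x; auto simp: gen_t_def gen_T_def fset_eq_iff algebra_simps simp del: foldr_replicate)+
  have "word_prod lamplighter r = code (foldr lmult
      ([gen_a] @ replicate (k + 1) gen_t @ [gen_a] @ replicate (k + 1) gen_T) ({||}, 0))"
    by (subst word_prod_map_code[symmetric]) (simp add: r_def)
  also have "\<dots> = code (toggle {|0|} {|int k + 1|}, 0)"
    by (simp add: power gen_a_def fset_eq_iff add.commute del: replicate.simps foldr_replicate)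
  finally have "word_prod lamplighter r = code (toggle {|0|} {|int k + 1|}, 0)" .
  hence "word_prod lamplighter (r @ r) = \<one>\<^bsub>lamplighter\<^esub>"
    using LL.gens_words_closed[OF _ r] by (simp add: one_lamplighter fset_eq_iff del: in_lists_conv_set)
  moreover have "foldl ?act (False, {}, 0) (r @ r) \<noteq> (False, {}, 0)"
    by (simp add: r_def foldl_cover_act_replicate del: replicate.simps)
  moreover have "foldl ?act x w = x" if w: "w \<in> lists ?S" "length w < k" "word_prod lamplighter w = \<one>\<^bsub>lamplighter\<^esub>" for w x
  proof -
    obtain c F n where x: "x = (c, F, n)" by (cases x)
    show ?thesis
      using cover_act_short[of w "int k + 1" c F n] w by (auto simp: x sym_gens_lamplighter one_lamplighter)
  qed
  ultimately show "\<exists>act :: bool \<times> int set \<times> int \<Rightarrow> nat \<Rightarrow> bool \<times> int set \<times> int.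
      (\<forall>w \<in> lists ?S. length w < k \<longrightarrow> word_prod lamplighter w = \<one>\<^bsub>lamplighter\<^esub> \<longrightarrow> (\<forall>x. foldl act x w = x)) \<and>
      (\<exists>r \<in> lists ?S. length r \<le> 8 * k + 8 \<and> word_prod lamplighter r = \<one>\<^bsub>lamplighter\<^esub> \<and> (\<exists>x. foldl act x r \<noteq> x))"
    using rr by (intro exI[of _ ?act]) blast
qed

section \<open>Automata checking a local rule\<close>

text \<open>
  A word is followed by blanks, represented by the letter \<open>0\<close>. For languages whose words do not end in \<open>0\<close> this loses nothing,
  and a relation between words of different lengths becomes one between infinite sequences.
\<close>

definition nth_pad :: "nat list \<Rightarrow> nat \<Rightarrow> nat" where
  "nth_pad u j = (if j < length u then u ! j else 0)"

lemma nth_pad_simps [simp]: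
  "nth_pad [] j = 0" "nth_pad (a # u) 0 = a" "nth_pad (a # u) (Suc j) = nth_pad u j"
  by (auto simp: nth_pad_def)

definition pad :: "nat option \<times> nat option \<Rightarrow> nat \<times> nat" where
  "pad c = (case fst c of None \<Rightarrow> 0 | Some a \<Rightarrow> a, case snd c of None \<Rightarrow> 0 | Some a \<Rightarrow> a)"

lemma pad_nth_convolution:
  "j < max (length u) (length v) \<Longrightarrow> pad (convolution u v ! j) = (nth_pad u j, nth_pad v j)"
  by (induction u v arbitrary: j rule: convolution.induct) (case_tac j; auto simp: pad_def)+

definition ends_persist :: "('a option \<times> 'a option) \<Rightarrow> ('a option \<times> 'a option) \<Rightarrow> bool" where
  "ends_persist c d \<longleftrightarrow> (fst c = None \<longrightarrow> fst d = None) \<and> (snd c = None \<longrightarrow> snd d = None)"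

lemma track_ended:
  assumes "successively ends_persist (c # w)"
  shows "fst c = None \<Longrightarrow> track1 w = []" "snd c = None \<Longrightarrow> track2 w = []"
  using assms by (induction w arbitrary: c) (auto simp: ends_persist_def)

text \<open>The convolutions are the words over pairs in which an ended tape never resumes, which is itself a condition
on neighbouring letters.\<close>

lemma convolution_of_tracks:
  assumes "successively ends_persist w" "(None, None) \<notin> set w"
  shows "convolution (track1 w) (track2 w) = w"
  using assms
proof (induction w)
  case (Cons c w)
  hence IH: "convolution (track1 w) (track2 w) = w" by (auto simp: successively_Cons)
  show ?case using IH track_ended[OF Cons.prems(1)] Cons.prems(2)
    by (cases c; cases "fst c"; cases "snd c") auto
qed simp

lemma ends_persist_convolution: "successively ends_persist (convolution u v)"
proof (induction u v rule: convolution.induct)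
  case (2 a u)
  thus ?case by (cases u) (auto simp: ends_persist_def)
next
  case (3 b v)
  thus ?case by (cases v) (auto simp: ends_persist_def)
qed (auto simp: successively_Cons ends_persist_def)

lemma convolution_padded_pairs:
  "u \<in> lists \<Sigma> \<Longrightarrow> v \<in> lists \<Sigma> \<Longrightarrow> convolution u v \<in> lists (padded_pairs \<Sigma>)"
  by (induction u v rule: convolution.induct) (auto simp: padded_pairs_def)

lemma tracks_padded_pairs:
  "w \<in> lists (padded_pairs \<Sigma>) \<Longrightarrow> track1 w \<in> lists \<Sigma> \<and> track2 w \<in> lists \<Sigma>"
  by (induction w) (auto simp: padded_pairs_def)

lemma local_rule_convolution:
  assumes "P (0, 0) (0, 0)"
  shows "(\<forall>j. P (nth_pad u j, nth_pad v j) (nth_pad u (Suc j), nth_pad v (Suc j))) \<longleftrightarrow>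
    successively (\<lambda>c d. P (pad c) (pad d)) (convolution u v) \<and>
    (convolution u v \<noteq> [] \<longrightarrow> P (pad (last (convolution u v))) (0, 0))" (is "?L \<longleftrightarrow> ?R")
proof -
  let ?w = "convolution u v" and ?x = "\<lambda>j. (nth_pad u j, nth_pad v j)"
  have w: "pad (?w ! j) = ?x j" if "j < length ?w" for j
    using that pad_nth_convolution by simp
  have out: "?x j = (0, 0)" if "j \<ge> length ?w" for j
    using that by (simp add: nth_pad_def)
  have last: "pad (last ?w) = ?x (length ?w - 1)" if "?w \<noteq> []"
    using that w[of "length ?w - 1"] by (simp add: last_conv_nth del: length_convolution)
  have "?L \<longleftrightarrow> (\<forall>j. Suc j < length ?w \<longrightarrow> P (?x j) (?x (Suc j))) \<and>
      (?w \<noteq> [] \<longrightarrow> P (?x (length ?w - 1)) (0, 0))" (is "_ \<longleftrightarrow> ?M")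
  proof
    assume L: ?L
    moreover have "Suc (length ?w - 1) = length ?w" if "?w \<noteq> []"
      using that by (simp del: length_convolution)
    ultimately show ?M using out[of "length ?w"] by (metis order_refl)
  next
    assume M: ?M
    show ?L
    proof
      fix j
      consider "Suc j < length ?w" | "Suc j = length ?w" | "j \<ge> length ?w" by linarith
      thus "P (?x j) (?x (Suc j))"
      proof cases
        case 2
        hence "?w \<noteq> []" "j = length ?w - 1" by (auto simp del: length_convolution)
        thus ?thesis using M out[of "Suc j"] 2 by (simp del: length_convolution)
      qed (use M assms out[of j] out[of "Suc j"] in auto)
    qed
  qed
  also have "\<dots> \<longleftrightarrow> ?R"
    using last w by (auto simp: successively_conv_nth simp del: length_convolution)
  finally show ?thesis .
qed

text \<open>The invariants of a word over pairs are the states that both tapes have reached, its last letter, and whether all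
rules have been obeyed so far. At the end the last letter is compared with the blanks that follow.\<close>

lemma sync_recognizable_local:
  assumes fin: "finite \<Sigma>" and reg: "regular_language \<Sigma> L" and P: "P (0, 0) (0, 0)"
  shows "sync_recognizable \<Sigma> {(u, v) \<in> L \<times> L. P0 (nth_pad u 0, nth_pad v 0) \<and>
    (\<forall>j. P (nth_pad u j, nth_pad v j) (nth_pad u (Suc j), nth_pad v (Suc j)))}"
    (is "sync_recognizable \<Sigma> ?R")
proof -
  let ?\<Gamma> = "padded_pairs \<Sigma>"
  obtain M :: "(nat, nat) dfa" where M: "dfa_over \<Sigma> M" and L: "L = dfa_language \<Sigma> M"
    using reg by (auto simp: regular_language_def)
  define run where "run u = foldl (dfa_next M) (dfa_init M) u" for u
  have LI: "u \<in> L \<longleftrightarrow> u \<in> lists \<Sigma> \<and> run u \<in> dfa_final M" for u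
    by (auto simp: L dfa_language_def run_def)
  have run: "run u \<in> dfa_states M" if "u \<in> lists \<Sigma>" for u
    using dfa_state_closed[OF M that] M by (auto simp: run_def dfa_over_def)
  define good where "good c d \<longleftrightarrow> ends_persist c d \<and> P (pad c) (pad d)" for c d
  define st where "st w = (run (track1 w), run (track2 w), if w = [] then None else Some (last w),
     w \<noteq> [] \<longrightarrow> P0 (pad (hd w)), successively good w)" for w
  define F where "F = (\<lambda>(q1, q2, l, b0, b). q1 \<in> dfa_final M \<and> q2 \<in> dfa_final M \<and> b0 \<and> b \<and>
     (case l of None \<Rightarrow> P0 (0, 0) | Some c \<Rightarrow> P (pad c) (0, 0)))"
  have split: "successively good w \<longleftrightarrow>
      successively ends_persist w \<and> successively (\<lambda>c d. P (pad c) (pad d)) w" for w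
    unfolding good_def by (induction w) (auto simp: successively_Cons)
  have conv: "(u, v) \<in> ?R \<longleftrightarrow> F (st (convolution u v))" if "u \<in> lists \<Sigma>" "v \<in> lists \<Sigma>" for u v
  proof -
    let ?w = "convolution u v"
    have "P0 (nth_pad u 0, nth_pad v 0) \<longleftrightarrow> (if ?w = [] then P0 (0, 0) else P0 (pad (hd ?w)))"
      by (cases "(u, v)" rule: convolution.cases) (auto simp: pad_def)
    thus ?thesis
      using that local_rule_convolution[of P u v, OF P] LI[of u] LI[of v]
      by (auto simp: F_def st_def split ends_persist_convolution split: if_splits)
  qed
  have "regular_language ?\<Gamma> ((\<lambda>(u, v). convolution u v) ` ?R)"
  proof (rule regular_languageI[where st = st and F = F])
    have "st ` lists ?\<Gamma> \<subseteq> dfa_states M \<times> dfa_states M \<times> insert None (Some ` ?\<Gamma>) \<times> UNIV \<times> UNIV"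
    proof (rule image_subsetI)
      fix w assume w: "w \<in> lists ?\<Gamma>"
      hence "w \<noteq> [] \<Longrightarrow> last w \<in> ?\<Gamma>" by auto
      thus "st w \<in> dfa_states M \<times> dfa_states M \<times> insert None (Some ` ?\<Gamma>) \<times> UNIV \<times> UNIV"
        using tracks_padded_pairs[OF w] run by (auto simp: st_def simp del: in_lists_conv_set)
    qed
    moreover have "finite ?\<Gamma>" "finite (dfa_states M)"
      using fin M by (auto simp: padded_pairs_def dfa_over_def)
    ultimately show "finite (st ` lists ?\<Gamma>)" by - (erule finite_subset, simp)
  next
    fix u v a assume "st u = st v"
    thus "st (u @ [a]) = st (v @ [a])"
      by (auto simp: st_def run_def successively_append_iff hd_append split: if_splits option.splits)
  next
    fix w assume w: "w \<in> lists ?\<Gamma>"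
    have none: "(None, None) \<notin> set w" using w by (auto simp: padded_pairs_def)
    show "w \<in> (\<lambda>(u, v). convolution u v) ` ?R \<longleftrightarrow> F (st w)"
    proof
      assume "w \<in> (\<lambda>(u, v). convolution u v) ` ?R"
      then obtain u v where "(u, v) \<in> ?R" and w: "w = convolution u v" by auto
      hence "u \<in> lists \<Sigma>" "v \<in> lists \<Sigma>" "(u, v) \<in> ?R" using LI by auto
      thus "F (st w)" using conv[of u v] w by simp
    next
      assume F: "F (st w)"
      hence "successively ends_persist w" by (simp add: F_def st_def split)
      hence eq: "convolution (track1 w) (track2 w) = w" using none by (rule convolution_of_tracks)
      hence "(track1 w, track2 w) \<in> ?R" using conv[of "track1 w" "track2 w"] tracks_padded_pairs[OF w] F by simp
      thus "w \<in> (\<lambda>(u, v). convolution u v) ` ?R" using eq by (intro image_eqI[of _ _ "(track1 w, track2 w)"]) auto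
    qed
  next
    show "(\<lambda>(u, v). convolution u v) ` ?R \<subseteq> lists ?\<Gamma>"
    proof (rule image_subsetI)
      fix p assume p: "p \<in> ?R"
      obtain u v where uv: "p = (u, v)" by (cases p)
      hence "u \<in> lists \<Sigma>" "v \<in> lists \<Sigma>" using p LI by simp_all
      thus "(case p of (u, v) \<Rightarrow> convolution u v) \<in> lists ?\<Gamma>"
        using convolution_padded_pairs uv by (simp del: in_lists_conv_set)
    qed
  qed
  thus ?thesis using LI by (auto simp: sync_recognizable_def)
qed

section \<open>A Cayley automatic representation of the lamplighter group\<close>

text \<open>
  The letter \<open>j\<close> of the folded line: two bits for the lamps at \<open>j\<close> and \<open>- 1 - j\<close>, and in the next two bits \<open>1\<close> or \<open>2\<close> if
  the lamplighter stands at the former or at the latter.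
\<close>

fun cell :: "lamps \<Rightarrow> nat \<Rightarrow> nat" where
  "cell (f, n) j = of_bool (int j |\<in>| f) + 2 * of_bool (- 1 - int j |\<in>| f)
     + 4 * (if n = int j then 1 else if n = - 1 - int j then 2 else 0)"

lemma cell_less: "cell g j < 12" by (cases g) auto

lemma cell_parts:
  "odd (cell (f, n) j) \<longleftrightarrow> int j |\<in>| f" "odd (cell (f, n) j div 2) \<longleftrightarrow> - 1 - int j |\<in>| f"
  "cell (f, n) j div 4 = (if n = int j then 1 else if n = - 1 - int j then 2 else 0)"
  by auto

declare cell.simps [simp del]

lemma int_fold_cases:
  obtains j where "p = int j" | j where "p = - 1 - int j"
proof -
  have "p = int (nat p) \<or> p = - 1 - int (nat (- 1 - p))" by linarith
  thus thesis using that by blast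
qed

lemma fset_eq_folded:
  "f = f' \<longleftrightarrow> (\<forall>j. (int j |\<in>| f \<longleftrightarrow> int j |\<in>| f') \<and> (- 1 - int j |\<in>| f \<longleftrightarrow> - 1 - int j |\<in>| f'))"
  unfolding fset_eq_iff by (metis int_fold_cases)

lemma cell_inj:
  assumes "\<And>j. cell g j = cell h j"
  shows "g = h"
proof -
  obtain f n f' n' where gh: "g = (f, n)" "h = (f', n')" by (cases g, cases h)
  have eq: "cell (f, n) j = cell (f', n') j" for j using assms[of j] by (simp only: gh)
  have "f = f'" unfolding fset_eq_folded
  proof (intro allI conjI)
    fix j
    show "int j |\<in>| f \<longleftrightarrow> int j |\<in>| f'"
      using arg_cong[OF eq[of j], of odd] by (simp only: cell_parts)
    show "- 1 - int j |\<in>| f \<longleftrightarrow> - 1 - int j |\<in>| f'"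
      using arg_cong[OF eq[of j], of "\<lambda>x. odd (x div 2)"] by (simp only: cell_parts)
  qed
  moreover have "n = n'"
  proof (cases n rule: int_fold_cases)
    case (1 j)
    thus ?thesis using arg_cong[OF eq[of j], of "\<lambda>x. x div 4"] unfolding cell_parts
      by (simp split: if_splits)
  next
    case (2 j)
    thus ?thesis using arg_cong[OF eq[of j], of "\<lambda>x. x div 4"] unfolding cell_parts
      by (simp split: if_splits)
  qed
  ultimately show ?thesis by (simp add: gh)
qed

text \<open>Every configuration is blank far away, and cutting the blanks off makes the word unique. Letters from \<open>4\<close> on
carry the lamplighter.\<close>

definition folded_words :: "nat list set" where
  "folded_words = {w \<in> lists {..<12}. (w \<noteq> [] \<longrightarrow> last w \<noteq> 0) \<and> length (filter (\<lambda>x. x \<ge> 4) w) = 1}"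

lemma regular_folded_words: "regular_language {..<12} folded_words"
proof (rule regular_languageI[where st = "\<lambda>w. (min 2 (length (filter (\<lambda>x. x \<ge> 4) w)), w \<noteq> [] \<and> last w = 0)"
    and F = "\<lambda>(k, b). k = 1 \<and> \<not> b"])
  have "(\<lambda>w. (min 2 (length (filter (\<lambda>x. x \<ge> 4) w)), w \<noteq> [] \<and> last w = 0)) ` lists {..<12 :: nat}
    \<subseteq> {..2 :: nat} \<times> UNIV" by auto
  thus "finite ((\<lambda>w. (min 2 (length (filter (\<lambda>x. x \<ge> 4) w)), w \<noteq> [] \<and> last w = 0)) ` lists {..<12 :: nat})"
    by (rule finite_subset) simp
qed (auto simp: folded_words_def min_def split: if_splits)

lemma nth_pad_inj:
  assumes "u \<noteq> [] \<Longrightarrow> last u \<noteq> 0" "v \<noteq> [] \<Longrightarrow> last v \<noteq> 0" and eq: "\<And>j. nth_pad u j = nth_pad v j"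
  shows "u = v"
proof -
  have le: "length u \<le> length v" if "u \<noteq> [] \<Longrightarrow> last u \<noteq> 0" "\<And>j. nth_pad u j = nth_pad v j" for u v
  proof (rule ccontr)
    assume "\<not> length u \<le> length v"
    hence "u \<noteq> []" "length u - 1 \<ge> length v" "length u - 1 < length u" by auto
    thus False using that(1) that(2)[of "length u - 1"] by (simp add: nth_pad_def last_conv_nth split: if_splits)
  qed
  hence "length u = length v" using le[of u v] le[of v u] assms by force
  thus ?thesis using eq by (intro nth_equalityI) (auto simp: nth_pad_def split: if_splits, metis)
qed

lemma nth_pad_exists:
  fixes c :: "nat \<Rightarrow> nat"
  assumes "\<And>j. j \<ge> N \<Longrightarrow> c j = 0"
  shows "\<exists>w. (w \<noteq> [] \<longrightarrow> last w \<noteq> 0) \<and> (\<forall>j. nth_pad w j = c j)"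
  using assms
proof (induction N)
  case 0
  thus ?case by (intro exI[of _ "[]"]) simp
next
  case (Suc N)
  show ?case
  proof (cases "c N = 0")
    case True
    thus ?thesis using Suc by (metis le_eq_less_or_eq not_less_eq_eq Suc_leI)
  next
    case False
    have "nth_pad (map c [0..<Suc N]) j = c j" for j
      using Suc.prems[of j] by (auto simp: nth_pad_def simp del: upt_Suc)
    thus ?thesis using False by (intro exI[of _ "map c [0..<Suc N]"]) simp
  qed
qed

lemma folded_word_of:
  "\<exists>w \<in> folded_words. \<forall>j. nth_pad w j = cell g j"
proof -
  obtain f n where g: "g = (f, n)" by (cases g)
  define B where "B = insert \<bar>n\<bar> ((\<lambda>i. \<bar>i\<bar>) ` fset f)"
  obtain N where N: "\<forall>b\<in>B. b \<le> int N"
  proof -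
    have "finite (nat ` B)" by (simp add: B_def)
    then obtain N where "\<forall>x \<in> nat ` B. x \<le> N" using finite_nat_set_iff_bounded_le by blast
    thus thesis by (intro that[of N]) (auto simp: nat_le_iff)
  qed
  have out: "cell g j = 0" if "j \<ge> Suc N" for j
  proof -
    have "n \<noteq> int j" "n \<noteq> - 1 - int j" "int j |\<notin>| f" "- 1 - int j |\<notin>| f"
      using N that by (auto simp: B_def)
    thus ?thesis by (simp add: g cell.simps)
  qed
  obtain w where w: "w \<noteq> [] \<longrightarrow> last w \<noteq> 0" "\<And>j. nth_pad w j = cell g j"
    using nth_pad_exists[of "Suc N" "cell g"] out by blast
  define j0 where "j0 = (if n \<ge> 0 then nat n else nat (- 1 - n))"
  have head: "cell g j \<ge> 4 \<longleftrightarrow> j = j0" for j by (auto simp: g j0_def cell.simps)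
  have "j0 < length w" using head[of j0] w(2)[of j0] by (simp add: nth_pad_def split: if_splits)
  hence "{i. i < length w \<and> w ! i \<ge> 4} = {j0}"
    using head w(2) by (auto simp: nth_pad_def) metis+
  hence "length (filter (\<lambda>x. x \<ge> 4) w) = 1" by (simp add: length_filter_conv_card)
  moreover have "w \<in> lists {..<12}"
  proof -
    have "w ! i < 12" if "i < length w" for i
      using cell_less[of g i] w(2)[of i] that by (simp add: nth_pad_def)
    thus ?thesis by (auto simp: in_set_conv_nth)
  qed
  ultimately show ?thesis using w by (intro bexI[of _ w]) (auto simp: folded_words_def)
qed

lemma folded_word_element:
  assumes w: "w \<in> folded_words"
  shows "\<exists>g. \<forall>j. nth_pad w j = cell g j"
proof -
  have "card {i. i < length w \<and> w ! i \<ge> 4} = 1"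
    using w by (simp add: folded_words_def length_filter_conv_card)
  then obtain j0 where j0: "{i. i < length w \<and> w ! i \<ge> 4} = {j0}" by (rule card_1_singletonE)
  have less: "nth_pad w j < 12" for j using w by (auto simp: nth_pad_def folded_words_def)
  have head: "nth_pad w j \<ge> 4 \<longleftrightarrow> j = j0" for j using j0 by (auto simp: nth_pad_def)
  define n where "n = (if nth_pad w j0 div 4 = 1 then int j0 else - 1 - int j0)"
  define X where "X = {p. if p \<ge> 0 then odd (nth_pad w (nat p)) else odd (nth_pad w (nat (- 1 - p)) div 2)}"
  have "X \<subseteq> {- 1 - int (length w)..int (length w)}"
    by (auto simp: X_def nth_pad_def split: if_splits)
  hence "finite X" by (rule finite_subset) simp
  define f where "f = Abs_fset X"
  have f: "p |\<in>| f \<longleftrightarrow> p \<in> X" for p using \<open>finite X\<close> by (simp add: f_def Abs_fset_inverse)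
  have "nth_pad w j = cell (f, n) j" for j
  proof -
    have split: "x = of_bool (odd x) + 2 * of_bool (odd (x div 2)) + 4 * (x div 4)" for x :: nat
      by (cases "odd x"; cases "odd (x div 2)"; simp; presburger)
    have "nth_pad w j div 4 = (if n = int j then 1 else if n = - 1 - int j then 2 else 0)"
      using head[of j] less[of j] by (auto simp: n_def)
    thus ?thesis by (subst split) (simp add: f X_def cell.simps)
  qed
  thus ?thesis by blast
qed

definition folded_value :: "nat list \<Rightarrow> lamps" where
  "folded_value w = (THE g. \<forall>j. nth_pad w j = cell g j)"

lemma folded_value:
  assumes "w \<in> folded_words"
  shows "nth_pad w j = cell (folded_value w) j"
proof -
  obtain g where g: "\<forall>j. nth_pad w j = cell g j" using folded_word_element[OF assms] by blast
  have "folded_value w = g"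
    unfolding folded_value_def
  proof (rule the_equality)
    show "\<forall>j. nth_pad w j = cell g j" by (rule g)
  next
    fix h assume "\<forall>j. nth_pad w j = cell h j"
    hence "cell h j = cell g j" for j using g by metis
    thus "h = g" by (rule cell_inj)
  qed
  thus ?thesis using g by simp
qed

lemma bij_folded_value: "bij_betw folded_value folded_words UNIV"
proof (rule bij_betwI')
  fix u v assume uv: "u \<in> folded_words" "v \<in> folded_words"
  show "folded_value u = folded_value v \<longleftrightarrow> u = v"
  proof
    assume "folded_value u = folded_value v"
    hence "nth_pad u j = nth_pad v j" for j by (simp only: folded_value[OF uv(1)] folded_value[OF uv(2)])
    thus "u = v" using uv by (intro nth_pad_inj) (simp_all add: folded_words_def)
  qed simp
next
  fix g :: lamps
  obtain w where w: "w \<in> folded_words" "\<forall>j. nth_pad w j = cell g j" using folded_word_of by blast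
  have "g = folded_value w" by (rule cell_inj) (use w folded_value[OF w(1)] in simp)
  thus "\<exists>w \<in> folded_words. g = folded_value w" using w(1) by blast
qed simp

text \<open>The pairs are the letters of the two words at the same place, and for \<open>rule_t\<close> at two consecutive places. A step
forwards moves the lamplighter away from the origin on the first half of the line and towards it on the second half. So
the letter of the source is compared with the next letter of the target on the first half, and the next letter of the source
with that of the target on the second. The step from \<open>- 1\<close> to \<open>0\<close> stays within the first letter.\<close>

definition rule_a where
  "rule_a = (\<lambda>(x, y). x div 4 = y div 4 \<and> (odd y \<longleftrightarrow> odd x \<noteq> (x div 4 = 1)) \<and>
     (odd (y div 2) \<longleftrightarrow> odd (x div 2) \<noteq> (x div 4 = (2 :: nat))))"

definition rule_t where
  "rule_t = (\<lambda>(x, y) (x', y'). (odd x \<longleftrightarrow> odd y) \<and> (odd (x div 2) \<longleftrightarrow> odd (y div 2)) \<and>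
     (y' div 4 = 1 \<longleftrightarrow> x div 4 = 1) \<and> (x' div 4 = 2 \<longleftrightarrow> y div 4 = (2 :: nat)))"

definition rule_t_start where
  "rule_t_start = (\<lambda>(x, y). y div 4 = 1 \<longleftrightarrow> x div 4 = (2 :: nat))"

lemma rule_a:
  "lmult g gen_a = h \<longleftrightarrow> (\<forall>j. rule_a (cell g j, cell h j))"
proof -
  obtain f n f' n' where gh: "g = (f, n)" "h = (f', n')" by (cases g, cases h)
  show ?thesis unfolding gh lmult_gens rule_a_def prod.case cell_parts
  proof
    assume *: "\<forall>j. (if n = int j then 1 else if n = - 1 - int j then 2 else 0) =
         (if n' = int j then 1 else if n' = - 1 - int j then 2 else (0 :: nat)) \<and>
         (int j |\<in>| f' \<longleftrightarrow> (int j |\<in>| f) \<noteq>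
           ((if n = int j then 1 else if n = - 1 - int j then 2 else 0) = (1 :: nat))) \<and>
         (- 1 - int j |\<in>| f' \<longleftrightarrow> (- 1 - int j |\<in>| f) \<noteq>
           ((if n = int j then 1 else if n = - 1 - int j then 2 else 0) = (2 :: nat)))"
    have "n = n'"
    proof (cases n rule: int_fold_cases)
      case (1 j)
      thus ?thesis using *[rule_format, of j] by (simp split: if_splits)
    next
      case (2 j)
      thus ?thesis using *[rule_format, of j] by (simp split: if_splits)
    qed
    moreover have "toggle f {|n|} = f'" unfolding fset_eq_folded
    proof
      fix j
      show "(int j |\<in>| toggle f {|n|} \<longleftrightarrow> int j |\<in>| f') \<and>
          (- 1 - int j |\<in>| toggle f {|n|} \<longleftrightarrow> - 1 - int j |\<in>| f')"
        using *[rule_format, of j] by (cases "n = int j"; cases "n = - 1 - int j") auto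
    qed
    ultimately show "(toggle f {|n|}, n) = (f', n')" by simp
  qed auto
qed

lemma rule_t:
  "lmult g gen_t = h \<longleftrightarrow> rule_t_start (cell g 0, cell h 0) \<and>
     (\<forall>j. rule_t (cell g j, cell h j) (cell g (Suc j), cell h (Suc j)))"
proof -
  obtain f n f' n' where gh: "g = (f, n)" "h = (f', n')" by (cases g, cases h)
  define head :: "int \<Rightarrow> nat \<Rightarrow> nat" where
    "head n j = (if n = int j then 1 else if n = - 1 - int j then 2 else 0)" for n j
  note head = cell_parts(3)[folded head_def]
  show ?thesis
    unfolding gh lmult_gens rule_t_def rule_t_start_def prod.case cell_parts(1,2) head prod.inject
  proof
    assume "f = f' \<and> n + 1 = n'"
    thus "(head n' 0 = 1) = (head n 0 = 2) \<and> (\<forall>j. (int j |\<in>| f) = (int j |\<in>| f') \<and>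
        (- 1 - int j |\<in>| f) = (- 1 - int j |\<in>| f') \<and>
        (head n' (Suc j) = 1) = (head n j = 1) \<and> (head n (Suc j) = 2) = (head n' j = 2))"
      by (auto simp: head_def split: if_splits)
  next
    assume *: "(head n' 0 = 1) = (head n 0 = 2) \<and> (\<forall>j. (int j |\<in>| f) = (int j |\<in>| f') \<and>
        (- 1 - int j |\<in>| f) = (- 1 - int j |\<in>| f') \<and>
        (head n' (Suc j) = 1) = (head n j = 1) \<and> (head n (Suc j) = 2) = (head n' j = 2))"
    have "f = f'" unfolding fset_eq_folded using * by blast
    moreover have "n + 1 = n'"
    proof (cases n rule: int_fold_cases)
      case (1 j)
      hence "head n j = 1" by (simp add: head_def)
      hence "head n' (Suc j) = 1" using * by blast
      thus ?thesis using 1 by (simp add: head_def split: if_splits)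
    next
      case (2 j)
      show ?thesis
      proof (cases j)
        case 0
        hence "head n 0 = 2" using 2 by (simp add: head_def)
        hence "head n' 0 = 1" using * by blast
        thus ?thesis using 0 2 by (simp add: head_def split: if_splits)
      next
        case (Suc k)
        hence "head n (Suc k) = 2" using 2 by (simp add: head_def)
        hence "head n' k = 2" using * by blast
        thus ?thesis using Suc 2 by (simp add: head_def split: if_splits)
      qed
    qed
    ultimately show "f = f' \<and> n + 1 = n'" by simp
  qed
qed

text \<open>The rule for a step backwards is the rule for a step forwards with the tapes exchanged.\<close>

lemma cayley_automatic_lamplighter: "cayley_automatic lamplighter lamp_gens"
proof -
  have eq: "code (folded_value u) \<otimes>\<^bsub>lamplighter\<^esub> code s = code (folded_value v) \<longleftrightarrow>
      lmult (folded_value u) s = folded_value v" for u v s by simp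
  have T: "lmult g gen_T = h \<longleftrightarrow> lmult h gen_t = g" for g h
    by (cases g; cases h) (auto simp: lmult_gens)
  have "sync_recognizable {..<12} {(u, v) \<in> folded_words \<times> folded_words.
      code (folded_value u) \<otimes>\<^bsub>lamplighter\<^esub> s = code (folded_value v)}"
    (is "sync_recognizable _ (?R s)")
    if s: "s \<in> sym_gens lamplighter lamp_gens" for s
  proof -
    let ?L = "\<lambda>P0 P. {(u, v) \<in> folded_words \<times> folded_words. P0 (nth_pad u 0, nth_pad v 0) \<and>
       (\<forall>j. P (nth_pad u j, nth_pad v j) (nth_pad u (Suc j), nth_pad v (Suc j)))}"
    have loc: "sync_recognizable {..<12} (?L P0 P)" if "P (0, 0) (0, 0)" for P0 P
      using regular_folded_words that by (intro sync_recognizable_local) auto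
    consider "s = code gen_a" | "s = code gen_t" | "s = code gen_T"
      using s by (auto simp: sym_gens_lamplighter)
    thus ?thesis
    proof cases
      case 1
      have R: "?R s = ?L (\<lambda>_. True) (\<lambda>c d. rule_a c)"
        unfolding 1 eq rule_a by (auto simp: folded_value)
      show ?thesis unfolding R by (rule loc) (simp add: rule_a_def)
    next
      case 2
      have R: "?R s = ?L rule_t_start rule_t"
        unfolding 2 eq rule_t by (auto simp: folded_value)
      show ?thesis unfolding R by (rule loc) (simp add: rule_t_def)
    next
      case 3
      have R: "?R s = ?L (\<lambda>c. rule_t_start (prod.swap c)) (\<lambda>c d. rule_t (prod.swap c) (prod.swap d))"
        unfolding 3 eq T rule_t by (auto simp: folded_value)
      show ?thesis unfolding R by (rule loc) (simp add: rule_t_def)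
    qed
  qed
  moreover have "bij_betw (\<lambda>w. code (folded_value w)) folded_words (range code)"
    using bij_betw_trans[OF bij_folded_value, of code "range code"]
    by (simp add: bij_betw_def inj_on_def comp_def)
  ultimately have "cayley_automatic_rep lamplighter lamp_gens {..<12} folded_words
      (\<lambda>w. code (folded_value w))"
    using regular_folded_words by (auto simp: cayley_automatic_rep_def folded_words_def)
  thus ?thesis unfolding cayley_automatic_def by blast
qed

section \<open>Machines that sweep the tape twice\<close>

text \<open>
  The states of a machine may come from any type, since only finitely many are used and these can be numbered.
\<close>

lemma pf_linear_timeI:
  fixes M :: "('s, 'a) tm"
  assumes M: "pf_tm \<Sigma> M" and comp: "tm_computes_within \<Sigma> M f (\<lambda>n. c * n + d)"
    and f: "f \<in> lists \<Sigma> \<rightarrow> lists \<Sigma>"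
  shows "pf_linear_time \<Sigma> f"
proof -
  let ?S = "tm_states M"
  have fin: "finite ?S" and init: "tm_init M \<in> ?S" and \<Sigma>: "\<Sigma> \<subseteq> tm_letters M" and acc: "tm_accept M \<subseteq> ?S"
    using M by (auto simp: pf_tm_def)
  have nxt: "q' \<in> ?S \<and> b \<in> tm_cells M \<and> (b = Boundary \<longleftrightarrow> a = Boundary) \<and> (a = Boundary \<longrightarrow> m \<noteq> MoveLeft)"
    if "q \<in> ?S" "a \<in> tm_cells M" "tm_next M q a = (q', b, m)" for q a q' b m
  proof -
    have "\<forall>q\<in>?S. \<forall>a\<in>tm_cells M. case tm_next M q a of (q', b, d) \<Rightarrow>
        q' \<in> ?S \<and> b \<in> tm_cells M \<and> (b = Boundary \<longleftrightarrow> a = Boundary) \<and> (a = Boundary \<longrightarrow> d \<noteq> MoveLeft)"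
      using M unfolding pf_tm_def by (elim conjE)
    from this[rule_format, OF that(1,2)] that(3) show ?thesis by simp
  qed
  obtain h :: "'s \<Rightarrow> nat" where h: "inj_on h ?S" using finite_imp_inj_to_nat_seg[OF fin] by blast
  define g where "g = inv_into ?S h"
  have gh: "g (h q) = q" if "q \<in> ?S" for q using h that by (simp add: g_def)
  define N where "N = \<lparr>tm_states = h ` ?S, tm_letters = tm_letters M, tm_init = h (tm_init M),
     tm_accept = h ` tm_accept M, tm_next = \<lambda>k a. case tm_next M (g k) a of (q, b, m) \<Rightarrow> (h q, b, m)\<rparr>"
  have cells: "tm_cells N = tm_cells M" by (simp add: tm_cells_def N_def)
  have accN: "h q \<in> tm_accept N \<longleftrightarrow> q \<in> tm_accept M" if "q \<in> ?S" for q
    using that acc h by (auto simp: N_def inj_on_def subset_iff)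
  have "case tm_next N k a of (k', b, m) \<Rightarrow> k' \<in> h ` ?S \<and> b \<in> tm_cells M \<and>
      (b = Boundary \<longleftrightarrow> a = Boundary) \<and> (a = Boundary \<longrightarrow> m \<noteq> MoveLeft)"
    if k: "k \<in> h ` ?S" and a: "a \<in> tm_cells M" for k a
  proof -
    obtain q where q: "q \<in> ?S" "k = h q" using k by blast
    obtain q' b m where n: "tm_next M q a = (q', b, m)" by (cases "tm_next M q a")
    thus ?thesis using nxt[OF q(1) a n] gh[OF q(1)] q(2) by (simp add: N_def)
  qed
  hence "pf_tm \<Sigma> N"
    using fin init \<Sigma> acc M unfolding pf_tm_def cells by (auto simp: N_def)
  moreover have "tm_computes_within \<Sigma> N f (\<lambda>n. c * n + d)"
    unfolding tm_computes_within_def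
  proof
    fix x assume x: "x \<in> lists \<Sigma>"
    have sim: "\<exists>q T p. tm_run M x t = (q, T, p) \<and> tm_run N x t = (h q, T, p) \<and> q \<in> ?S \<and> (\<forall>i. T i \<in> tm_cells M)" for t
    proof (induction t)
      case 0
      have "input_tape x i \<in> tm_cells M" for i
        using x \<Sigma> by (auto simp: input_tape_def tm_cells_def subset_iff)
      thus ?case using init by (auto simp: tm_run_def N_def)
    next
      case (Suc t)
      then obtain q T p where IH: "tm_run M x t = (q, T, p)" "tm_run N x t = (h q, T, p)" "q \<in> ?S"
        "\<And>i. T i \<in> tm_cells M" by blast
      have run: "tm_run K x (Suc t) = tm_step K (tm_run K x t)" for K :: "('b, 'a) tm"
        by (simp add: tm_run_def)
      show ?case
      proof (cases "q \<in> tm_accept M")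
        case True
        thus ?thesis using IH accN by (simp add: tm_run_def)
      next
        case False
        obtain q' b m where n: "tm_next M q (T p) = (q', b, m)" by (cases "tm_next M q (T p)")
        hence "tm_next N (h q) (T p) = (h q', b, m)" using gh IH(3) by (simp add: N_def)
        thus ?thesis using nxt[OF IH(3,4) n] n IH accN False by (simp add: tm_run_def)
      qed
    qed
    obtain t where t: "t \<le> c * length x + d" and "case tm_run M x t of (q, T, p) \<Rightarrow> q \<in> tm_accept M \<and> tape_has_output T (f x)"
      using bspec[OF comp[unfolded tm_computes_within_def] x] by (elim exE conjE) (rule that)
    thus "\<exists>t \<le> c * length x + d. case tm_run N x t of (q, T, p) \<Rightarrow> q \<in> tm_accept N \<and> tape_has_output T (f x)"
      using sim[of t] accN by (intro exI[of _ t]) auto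
  qed
  ultimately show ?thesis using f unfolding pf_linear_time_def by blast
qed

text \<open>A Mealy machine that reads the word from its beginning, and one that reads it from its end and may also
erase letters.\<close>

fun rsweep :: "('q \<Rightarrow> 'l \<Rightarrow> 'q \<times> 'l) \<Rightarrow> 'q \<Rightarrow> 'l list \<Rightarrow> 'l list \<times> 'q" where
  "rsweep \<delta> q [] = ([], q)"
| "rsweep \<delta> q (a # w) = (case \<delta> q a of (q', b) \<Rightarrow> case rsweep \<delta> q' w of (v, r) \<Rightarrow> (b # v, r))"

fun lsweep :: "('p \<Rightarrow> 'l \<Rightarrow> 'p \<times> 'l option) \<Rightarrow> 'p \<Rightarrow> 'l list \<Rightarrow> 'l option list \<times> 'p" where
  "lsweep \<epsilon> p [] = ([], p)"
| "lsweep \<epsilon> p (a # w) = (case lsweep \<epsilon> p w of (v, p') \<Rightarrow> case \<epsilon> p' a of (p'', b) \<Rightarrow> (b # v, p''))"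

text \<open>The output ends at the first blank, so a left sweep shortens the word by blanks at its end.\<close>

definition output_of :: "'l option list \<Rightarrow> 'l list" where
  "output_of cs = map the (takeWhile (\<lambda>c. c \<noteq> None) cs)"

definition two_sweeps where
  "two_sweeps \<delta> q0 \<rho> \<kappa> \<epsilon> w =
     (case rsweep \<delta> q0 w of (v, q) \<Rightarrow> output_of (fst (lsweep \<epsilon> (\<kappa> q) (v @ \<rho> q))))"

lemma length_rsweep [simp]: "length (fst (rsweep \<delta> q w)) = length w"
  by (induction w arbitrary: q) (simp_all add: split_beta)

datatype ('q, 'p, 'l) phase = Start | Rightwards 'q | Append "'l list" 'p | Leftwards 'p | Done

definition tape_of :: "'a cell list \<Rightarrow> nat \<Rightarrow> 'a cell" where
  "tape_of cs i = (if i < length cs then cs ! i else Blank)"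

lemma tape_of_nth [simp]:
  "tape_of (xs @ c # ys) (length xs) = c" "tape_of xs (length xs) = Blank"
  by (auto simp: tape_of_def)

lemma tape_of_update [simp]:
  "(tape_of (xs @ c # ys))(length xs := d) = tape_of (xs @ d # ys)"
  "(tape_of xs)(length xs := d) = tape_of (xs @ [d])"
  by (auto simp: tape_of_def fun_eq_iff nth_append nth_Cons split: nat.splits)

lemma tape_of_Blank [simp]: "tape_of (xs @ [Blank]) = tape_of xs"
  by (auto simp: tape_of_def fun_eq_iff nth_append)

lemma map_tape_of_Cons: "map (tape_of (c # cs)) [0..<Suc n] = c # map (tape_of cs) [0..<n]"
  by (simp add: map_upt_Suc tape_of_def del: upt_Suc)

lemma input_tape_eq: "input_tape x = tape_of (Boundary # map Letter x)"
  by (auto simp: tape_of_def fun_eq_iff input_tape_def nth_Cons split: nat.splits)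

lemma funpow_trans: "(f ^^ m) a = b \<Longrightarrow> (f ^^ n) b = c \<Longrightarrow> (f ^^ (m + n)) a = c"
  unfolding add.commute[of m n] funpow_add by simp

locale sweep_machine =
  fixes \<delta> :: "'q::finite \<Rightarrow> 'l::finite \<Rightarrow> 'q \<times> 'l" and q0 :: 'q and \<rho> :: "'q \<Rightarrow> 'l list" and \<kappa> :: "'q \<Rightarrow> 'p::finite"
    and \<epsilon> :: "'p \<Rightarrow> 'l \<Rightarrow> 'p \<times> 'l option" and enc :: "'l \<Rightarrow> 'a"
  assumes inj_enc: "inj enc"
begin

definition dec :: "'a \<Rightarrow> 'l" where "dec = inv_into UNIV enc"

lemma dec_enc [simp]: "dec (enc a) = a" using inj_enc by (simp add: dec_def)

abbreviation letter :: "'l \<Rightarrow> 'a cell" where "letter a \<equiv> Letter (enc a)"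

definition cell_of :: "'l option \<Rightarrow> 'a cell" where
  "cell_of c = (case c of None \<Rightarrow> Blank | Some a \<Rightarrow> letter a)"

fun next_phase :: "('q, 'p, 'l) phase \<Rightarrow> 'a cell \<Rightarrow> ('q, 'p, 'l) phase \<times> 'a cell \<times> move" where
  "next_phase Start Boundary = (Rightwards q0, Boundary, MoveRight)"
| "next_phase (Rightwards q) (Letter a) = (case \<delta> q (dec a) of (q', b) \<Rightarrow> (Rightwards q', letter b, MoveRight))"
| "next_phase (Rightwards q) Blank = (Append (\<rho> q) (\<kappa> q), Blank, Stay)"
| "next_phase (Append (y # ys) p) Blank = (Append ys p, letter y, MoveRight)"
| "next_phase (Append [] p) Blank = (Leftwards p, Blank, MoveLeft)"
| "next_phase (Leftwards p) (Letter a) = (case \<epsilon> p (dec a) of (p', b) \<Rightarrow> (Leftwards p', cell_of b, MoveLeft))"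
| "next_phase (Leftwards p) Boundary = (Done, Boundary, Stay)"
| "next_phase _ c = (Done, c, Stay)"

definition bound :: nat where "bound = Max (range (\<lambda>q. length (\<rho> q)))"

lemma length_le_bound: "length (\<rho> q) \<le> bound"
  unfolding bound_def by (rule Max_ge) auto

definition machine :: "(('q, 'p, 'l) phase, 'a) tm" where
  "machine = \<lparr>tm_states = {Start, Done} \<union> range Rightwards \<union> range Leftwards \<union>
       (\<lambda>(ys, p). Append ys p) ` ({ys. set ys \<subseteq> UNIV \<and> length ys \<le> bound} \<times> UNIV),
     tm_letters = range enc, tm_init = Start, tm_accept = {Done}, tm_next = next_phase\<rparr>"

lemma pf_tm_machine: "pf_tm (range enc) machine"
proof -
  have fin: "finite (tm_states machine)"
    using finite_lists_length_le[of "UNIV :: 'l set" bound] by (simp add: machine_def)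
  have "case next_phase s a of (s', b, d) \<Rightarrow> s' \<in> tm_states machine \<and> b \<in> tm_cells machine \<and>
      (b = Boundary \<longleftrightarrow> a = Boundary) \<and> (a = Boundary \<longrightarrow> d \<noteq> MoveLeft)"
    if "s \<in> tm_states machine" "a \<in> tm_cells machine" for s a
    using that length_le_bound
    by (cases "(s, a)" rule: next_phase.cases)
       (auto simp: machine_def tm_cells_def cell_of_def split: prod.splits option.splits)
  thus ?thesis unfolding pf_tm_def using fin by (auto simp: machine_def)
qed

abbreviation "step \<equiv> tm_step machine"

lemma step_simp: "s \<noteq> Done \<Longrightarrow> step (s, T, p) = (case next_phase s (T p) of (s', b, d) \<Rightarrow> (s', T(p := b), move_head d p))"
  by (simp add: machine_def)

lemma run_rightwards:
  "(step ^^ length w) (Rightwards q, tape_of (ds @ map letter w), length ds) =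
   (Rightwards (snd (rsweep \<delta> q w)), tape_of (ds @ map letter (fst (rsweep \<delta> q w))), length ds + length w)"
proof (induction w arbitrary: q ds)
  case (Cons a w)
  obtain q' b where \<delta>: "\<delta> q a = (q', b)" by (cases "\<delta> q a")
  have "step (Rightwards q, tape_of (ds @ map letter (a # w)), length ds) =
      (Rightwards q', tape_of ((ds @ [letter b]) @ map letter w), length (ds @ [letter b]))"
    by (simp add: step_simp \<delta> del: tm_step.simps)
  thus ?case using Cons.IH[of q' "ds @ [letter b]"]
    by (simp add: funpow_Suc_right \<delta> split: prod.splits del: funpow.simps tm_step.simps)
qed simp

lemma run_append:
  "(step ^^ length ys) (Append ys p, tape_of ds, length ds) =
   (Append [] p, tape_of (ds @ map letter ys), length ds + length ys)"
proof (induction ys arbitrary: ds)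
  case (Cons y ys)
  have "step (Append (y # ys) p, tape_of ds, length ds) =
      (Append ys p, tape_of (ds @ [letter y]), length (ds @ [letter y]))"
    by (simp add: step_simp del: tm_step.simps)
  thus ?case using Cons.IH[of "ds @ [letter y]"]
    by (simp add: funpow_Suc_right del: funpow.simps tm_step.simps)
qed simp

lemma run_leftwards:
  assumes "ds \<noteq> []"
  shows "(step ^^ length w) (Leftwards p, tape_of (ds @ map letter w @ es), length ds + length w - 1) =
   (Leftwards (snd (lsweep \<epsilon> p w)), tape_of (ds @ map cell_of (fst (lsweep \<epsilon> p w)) @ es), length ds - 1)"
  using assms
proof (induction w arbitrary: ds)
  case (Cons a w)
  obtain v p' where v: "lsweep \<epsilon> p w = (v, p')" by (cases "lsweep \<epsilon> p w")
  obtain p'' b where \<epsilon>: "\<epsilon> p' a = (p'', b)" by (cases "\<epsilon> p' a")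
  have "(step ^^ length w) (Leftwards p, tape_of (ds @ map letter (a # w) @ es), length ds + length (a # w) - 1) =
     (Leftwards p', tape_of (ds @ letter a # (map cell_of v @ es)), length ds)"
    using Cons.IH[of "ds @ [letter a]"] v by simp
  thus ?case by (simp add: v \<epsilon> step_simp del: tm_step.simps)
qed simp

lemma output_written:
  "tape_has_output (tape_of (Boundary # map cell_of cs)) (map enc (output_of cs))"
proof -
  have "map (tape_of (map cell_of cs)) [0..<Suc (length (output_of cs))] = map letter (output_of cs) @ [Blank]"
  proof (induction cs)
    case (Cons c cs)
    thus ?case
      by (cases c) (simp_all add: output_of_def cell_of_def map_tape_of_Cons del: upt_Suc)
  qed (simp add: output_of_def tape_of_def)
  thus ?thesis
    unfolding tape_has_output_def by (simp add: map_tape_of_Cons numeral_2_eq_2 del: upt_Suc)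
qed

lemma step_turn:
  "step (Rightwards q, tape_of ds, length ds) = (Append (\<rho> q) (\<kappa> q), tape_of ds, length ds)"
  "step (Append [] p, tape_of ds, length ds) = (Leftwards p, tape_of ds, length ds - 1)"
  by (simp_all add: step_simp del: tm_step.simps)

text \<open>Each sweep takes one step per cell; one step each is spent at the start, at both ends of the appended word, and at the
end. The longest word that may be appended bounds the rest of the time.\<close>

theorem pf_linear_time_two_sweeps:
  "pf_linear_time (range enc) (\<lambda>x. map enc (two_sweeps \<delta> q0 \<rho> \<kappa> \<epsilon> (map dec x)))" (is "pf_linear_time _ ?f")
proof (rule pf_linear_timeI[where M = machine and c = 2 and d = "2 * bound + 5"])
  show "tm_computes_within (range enc) machine ?f (\<lambda>n. 2 * n + (2 * bound + 5))"
    unfolding tm_computes_within_def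
  proof
    fix x assume x: "x \<in> lists (range enc)"
    define w where "w = map dec x"
    have "map enc (map dec x) = x" using x by (induction x) auto
    hence xw: "x = map enc w" by (simp add: w_def)
    obtain v q where v: "rsweep \<delta> q0 w = (v, q)" by (cases "rsweep \<delta> q0 w")
    have lv: "length v = length w" using length_rsweep[of \<delta> q0 w] v by simp
    obtain cs p where cs: "lsweep \<epsilon> (\<kappa> q) (v @ \<rho> q) = (cs, p)" by (cases "lsweep \<epsilon> (\<kappa> q) (v @ \<rho> q)")
    let ?B = "Boundary :: 'a cell" and ?n = "length w" and ?k = "length (\<rho> q)"
    let ?c0 = "(Start, input_tape x, 0) :: ('q, 'p, 'l) phase \<times> (nat \<Rightarrow> 'a cell) \<times> nat"
    have c1: "(step ^^ 1) ?c0 = (Rightwards q0, tape_of ([?B] @ map letter w), length [?B])"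
      using tape_of_update(1)[of "[]" ?B "map letter w" ?B] tape_of_nth(1)[of "[]" ?B "map letter w"]
      by (simp add: step_simp input_tape_eq xw comp_def del: tm_step.simps)
    have c2: "(step ^^ ?n) (Rightwards q0, tape_of ([?B] @ map letter w), length [?B]) =
        (Rightwards q, tape_of (?B # map letter v), length (?B # map letter v))"
      using run_rightwards[of w q0 "[?B]"] by (simp add: v lv)
    have c3: "(step ^^ 1) (Rightwards q, tape_of (?B # map letter v), length (?B # map letter v)) =
        (Append (\<rho> q) (\<kappa> q), tape_of (?B # map letter v), length (?B # map letter v))"
      using step_turn(1)[of q "?B # map letter v"] by simp
    have c4: "(step ^^ ?k) (Append (\<rho> q) (\<kappa> q), tape_of (?B # map letter v), length (?B # map letter v)) =
        (Append [] (\<kappa> q), tape_of (?B # map letter (v @ \<rho> q)), length (?B # map letter (v @ \<rho> q)))"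
      using run_append[of "\<rho> q" "\<kappa> q" "?B # map letter v"] by simp
    have c5: "(step ^^ 1) (Append [] (\<kappa> q), tape_of (?B # map letter (v @ \<rho> q)), length (?B # map letter (v @ \<rho> q))) =
        (Leftwards (\<kappa> q), tape_of ([?B] @ map letter (v @ \<rho> q) @ []), length [?B] + length (v @ \<rho> q) - 1)"
      using step_turn(2)[of "\<kappa> q" "?B # map letter (v @ \<rho> q)"] by simp
    have c6: "(step ^^ (?n + ?k)) (Leftwards (\<kappa> q), tape_of ([?B] @ map letter (v @ \<rho> q) @ []), length [?B] + length (v @ \<rho> q) - 1) =
        (Leftwards p, tape_of (?B # map cell_of cs), 0)"
      using run_leftwards[of "[?B]" "v @ \<rho> q" "\<kappa> q" "[]"] by (simp add: cs lv)
    have c7: "(step ^^ 1) (Leftwards p, tape_of (?B # map cell_of cs), 0) = (Done, tape_of (?B # map cell_of cs), 0)"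
      using tape_of_update(1)[of "[]" ?B "map cell_of cs" ?B] tape_of_nth(1)[of "[]" ?B "map cell_of cs"]
      by (simp add: step_simp del: tm_step.simps)
    let ?t = "1 + ?n + 1 + ?k + 1 + (?n + ?k) + 1"
    have "tm_run machine x ?t = (step ^^ ?t) ?c0" by (simp add: tm_run_def machine_def)
    also have "\<dots> = (Done, tape_of (?B # map cell_of cs), 0)"
      by (intro funpow_trans[OF _ c7] funpow_trans[OF _ c6] funpow_trans[OF _ c5] funpow_trans[OF _ c4]
          funpow_trans[OF _ c3] funpow_trans[OF c1 c2])
    finally have "tm_run machine x ?t = (Done, tape_of (?B # map cell_of cs), 0)" .
    moreover have "?f x = map enc (output_of cs)"
      by (simp add: two_sweeps_def v cs w_def[symmetric])
    moreover have "?t \<le> 2 * length x + (2 * bound + 5)"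
      using length_le_bound[of q] by (simp add: xw)
    ultimately show "\<exists>t \<le> 2 * length x + (2 * bound + 5). case tm_run machine x t of (s, T, p) \<Rightarrow>
        s \<in> tm_accept machine \<and> tape_has_output T (?f x)"
      using output_written[of cs]
      by (intro exI[of _ "?t"]) (simp add: machine_def)
  qed
qed (use pf_tm_machine in auto)

end

section \<open>A normal form in which every word is a path to its element\<close>

text \<open>
  Both \<open>P\<close> and \<open>T\<close> are steps backwards, before and after the lamps are set. The letter \<open>U b h\<close> toggles the
  current lamp if \<open>b\<close> and then moves one step forwards; the mark \<open>h\<close> tells the machines where the
  lamplighter stands.
\<close>

datatype letter = P | T | U bool bool

lemma UNIV_letter: "UNIV = {P, T} \<union> (\<lambda>(b, h). U b h) ` UNIV"
proof -
  have "x \<in> {P, T} \<union> (\<lambda>(b, h). U b h) ` UNIV" for x by (cases x) auto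
  thus ?thesis by auto
qed

instance letter :: finite
  by standard (subst UNIV_letter, simp)

fun letter_code :: "letter \<Rightarrow> nat" where
  "letter_code P = 0"
| "letter_code T = 1"
| "letter_code (U b h) = 2 + of_bool b + 2 * of_bool h"

lemma inj_letter_code: "inj letter_code"
proof (rule injI)
  fix x y assume "letter_code x = letter_code y"
  thus "x = y" by (cases x; cases y) (auto simp: of_bool_def split: if_splits)
qed

fun letter_value :: "letter \<Rightarrow> lamps" where
  "letter_value P = gen_T"
| "letter_value T = gen_T"
| "letter_value (U b h) = (if b then {|0|} else {||}, 1)"

definition path_value :: "letter list \<Rightarrow> lamps" where
  "path_value w = foldr lmult (map letter_value w) ({||}, 0)"

lemma path_value_append: "path_value (u @ v) = lmult (path_value u) (path_value v)"
  unfolding path_value_def by (induction u) (simp_all add: lmult_one lmult_assoc del: lmult.simps)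

fun lit :: "int \<Rightarrow> bool list \<Rightarrow> int fset" where
  "lit p [] = {||}"
| "lit p (b # bs) = toggle (if b then {|p|} else {||}) (lit (p + 1) bs)"

lemma toggle_simps [simp]: "toggle {||} f = f" "toggle f {||} = f" "toggle (toggle f g) h = toggle f (toggle g h)"
  by (auto simp: fset_eq_iff)

lemma lit_append [simp]: "lit p (bs @ cs) = toggle (lit p bs) (lit (p + int (length bs)) cs)"
  by (induction bs arbitrary: p) (simp_all add: algebra_simps)

lemma fmember_lit: "i |\<in>| lit p bs \<longleftrightarrow> p \<le> i \<and> nat (i - p) < length bs \<and> bs ! nat (i - p)"
proof (induction bs arbitrary: p)
  case (Cons b bs)
  show ?case
  proof (cases "p < i")
    case True
    hence "nat (i - p) = Suc (nat (i - (p + 1)))" by linarith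
    thus ?thesis using True by (simp add: Cons.IH)
  qed (auto simp: Cons.IH)
qed simp

text \<open>The lamps treated are those from \<open>- l\<close> on. The marked letter toggles the lamp at which the path is to end. One more
step back than there are lamps behind it is needed, since every \<open>U\<close> moves past its lamp.\<close>

definition path_word :: "nat \<Rightarrow> bool list \<Rightarrow> bool \<Rightarrow> bool list \<Rightarrow> letter list" where
  "path_word l xs b ys = replicate l P @ map (\<lambda>x. U x False) xs @ U b True # map (\<lambda>y. U y False) ys
     @ replicate (Suc (length ys)) T"

lemma path_value_replicate:
  "path_value (replicate l P) = ({||}, - int l)" "path_value (replicate l T) = ({||}, - int l)"
  unfolding path_value_def by (induction l) (simp_all add: gen_T_def fset_eq_iff del: foldr_replicate map_replicate)

lemma path_value_lamps: "path_value (map (\<lambda>x. U x False) xs) = (lit 0 xs, int (length xs))"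
proof (induction xs rule: rev_induct)
  case (snoc x xs)
  thus ?case by (auto simp: path_value_append) (auto simp: path_value_def fset_eq_iff)
qed (simp add: path_value_def)

lemma shift_lit: "shift n (lit p bs) = lit (n + p) bs"
  by (auto simp: fset_eq_iff fmember_lit algebra_simps)

lemma shift_toggle: "shift n (toggle f g) = toggle (shift n f) (shift n g)"
  and shift_empty: "shift n {||} = {||}" and shift_singleton: "shift n {|i|} = {|n + i|}"
  by (auto simp: fset_eq_iff)

text \<open>The steps back cancel the steps past the marked lamp, so the path ends there.\<close>

lemma path_value_path_word:
  "path_value (path_word l xs b ys) = (lit (- int l) (xs @ b # ys), int (length xs) - int l)"
proof -
  have word: "path_word l xs b ys = replicate l P @ map (\<lambda>x. U x False) xs @ [U b True]
      @ map (\<lambda>y. U y False) ys @ replicate (Suc (length ys)) T"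
    by (simp add: path_word_def)
  have mark: "path_value [U b True] = (lit 0 [b], 1)"
    by (auto simp: path_value_def fset_eq_iff)
  have "path_value (path_word l xs b ys) = lmult ({||}, - int l) (lmult (lit 0 xs, int (length xs))
      (lmult (lit 0 [b], 1) (lmult (lit 0 ys, int (length ys)) ({||}, - int (Suc (length ys))))))"
    by (simp only: word path_value_append path_value_replicate path_value_lamps mark)
  also have "\<dots> = (lit (- int l) (xs @ [b] @ ys), int (length xs) - int l)"
    by (simp add: shift_lit shift_toggle shift_empty shift_singleton algebra_simps)
  finally show ?thesis by simp
qed

text \<open>The interval of treated lamps contains the lamplighter, and it begins at or before the origin. It is made as small as possible: an
unlit lamp at its right end is allowed only under the lamplighter, and one at its left end only under the lamplighter or
at the origin.\<close>

definition trimmed :: "nat \<Rightarrow> bool list \<Rightarrow> bool list \<Rightarrow> bool" where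
  "trimmed l xs ys \<longleftrightarrow> (ys = [] \<or> last ys) \<and> (l = 0 \<or> xs = [] \<or> hd xs)"

definition path_words :: "letter list set" where
  "path_words = {path_word l xs b ys | l xs b ys. trimmed l xs ys}"

text \<open>The left end is the least of \<open>0\<close>, the position and the lit lamps, and the right end is the greatest of the position and the
lit lamps, so both can be read off from the element.\<close>

lemma trimmed_unique:
  assumes eq: "path_value (path_word l xs b ys) = path_value (path_word l' xs' b' ys')"
    and t: "trimmed l xs ys" "trimmed l' xs' ys'"
  shows "l = l' \<and> xs = xs' \<and> b = b' \<and> ys = ys'"
proof -
  have le: "l' \<le> l" if "lit (- int l) (xs @ b # ys) = lit (- int l') (xs' @ b' # ys')"
    "int (length xs) - int l = int (length xs') - int l'" "trimmed l' xs' ys'"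
    for l xs b ys l' xs' b' ys'
  proof (rule ccontr)
    assume "\<not> l' \<le> l"
    hence "xs' \<noteq> []" "hd xs'" using that(2,3) by (auto simp: trimmed_def)
    hence "- int l' |\<in>| lit (- int l') (xs' @ b' # ys')"
      by (simp add: fmember_lit nth_append hd_conv_nth del: lit_append)
    hence "- int l' |\<in>| lit (- int l) (xs @ b # ys)" by (simp only: that(1))
    thus False using \<open>\<not> l' \<le> l\<close> by (simp add: fmember_lit del: lit_append)
  qed
  have eqs: "lit (- int l) (xs @ b # ys) = lit (- int l') (xs' @ b' # ys')"
    "int (length xs) - int l = int (length xs') - int l'"
    using eq by (simp_all add: path_value_path_word del: lit_append lit.simps)
  have l: "l = l'" using le[OF eqs t(2)] le[OF eqs[symmetric] t(1)] by simp
  hence xs: "length xs = length xs'" using eqs(2) by simp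
  have nth: "(xs @ b # ys) ! i" if "i < length (xs' @ b' # ys')" "(xs' @ b' # ys') ! i"
      "lit p (xs @ b # ys) = lit p (xs' @ b' # ys')" for i p xs b ys xs' b' ys'
  proof -
    have "p + int i |\<in>| lit p (xs' @ b' # ys')" using that(1,2) by (simp add: fmember_lit del: lit_append)
    hence "p + int i |\<in>| lit p (xs @ b # ys)" by (simp only: that(3))
    thus ?thesis by (simp add: fmember_lit del: lit_append)
  qed
  have len: "length ys' \<le> length ys" if "lit p (xs @ b # ys) = lit p (xs' @ b' # ys')"
    "length xs = length xs'" "ys' = [] \<or> last ys'" for p xs b ys xs' b' ys'
  proof (rule ccontr)
    assume less: "\<not> length ys' \<le> length ys"
    hence "ys' \<noteq> []" by auto
    hence "(xs' @ b' # ys') ! (length xs' + length ys')" using that(3)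
      by (cases ys' rule: rev_cases) (auto simp: nth_append)
    hence "p + int (length xs' + length ys') |\<in>| lit p (xs' @ b' # ys')"
      by (simp add: fmember_lit nat_add_distrib del: lit_append)
    hence "p + int (length xs' + length ys') |\<in>| lit p (xs @ b # ys)" by (simp only: that(1))
    thus False using less that(2) by (simp add: fmember_lit nat_add_distrib del: lit_append)
  qed
  have "length ys = length ys'"
    using len[OF eqs(1)[folded l] xs] len[OF eqs(1)[folded l, symmetric] xs[symmetric]] t
    by (auto simp: trimmed_def)
  hence "xs @ b # ys = xs' @ b' # ys'"
    using nth[OF _ _ eqs(1)[folded l]] nth[OF _ _ eqs(1)[folded l, symmetric]] xs
    by (intro nth_equalityI) (auto simp del: lit_append)
  thus ?thesis using l xs by simp
qed

section \<open>Right multiplication on the normal form\<close>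

lemma rsweep_append:
  "rsweep \<delta> q (u @ v) = (fst (rsweep \<delta> q u) @ fst (rsweep \<delta> (snd (rsweep \<delta> q u)) v),
     snd (rsweep \<delta> (snd (rsweep \<delta> q u)) v))"
  by (induction u arbitrary: q) (simp_all add: split_beta)

lemma lsweep_append:
  "lsweep \<epsilon> p (u @ v) = (fst (lsweep \<epsilon> (snd (lsweep \<epsilon> p v)) u) @ fst (lsweep \<epsilon> p v),
     snd (lsweep \<epsilon> (snd (lsweep \<epsilon> p v)) u))"
  by (induction u) (simp_all add: split_beta)

lemma rsweep_copy: "(\<And>a. a \<in> set w \<Longrightarrow> \<delta> q a = (q, a)) \<Longrightarrow> rsweep \<delta> q w = (w, q)"
  by (induction w) auto

lemma lsweep_copy: "(\<And>a. a \<in> set w \<Longrightarrow> \<epsilon> p a = (p, Some a)) \<Longrightarrow> lsweep \<epsilon> p w = (map Some w, p)"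
  by (induction w) auto

lemma output_of_Some [simp]: "output_of (map Some w) = w" "output_of (map Some w @ None # cs) = w"
  by (induction w) (auto simp: output_of_def)

lemma rsweep_appendI:
  "rsweep \<delta> q u = (u', q') \<Longrightarrow> rsweep \<delta> q (u @ v) = (u' @ fst (rsweep \<delta> q' v), snd (rsweep \<delta> q' v))"
  by (simp add: rsweep_append)

lemma two_sweepsI:
  "rsweep \<delta> q0 w = (v, q) \<Longrightarrow> lsweep \<epsilon> (\<kappa> q) (v @ \<rho> q) = (cs, p) \<Longrightarrow> output_of cs = w' \<Longrightarrow>
   two_sweeps \<delta> q0 \<rho> \<kappa> \<epsilon> w = w'"
  by (simp add: two_sweeps_def)

subsection \<open>Toggling\<close>

definition sweep_a :: "letter list \<Rightarrow> letter list" where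
  "sweep_a = two_sweeps (\<lambda>_ c. ((), case c of U b True \<Rightarrow> U (\<not> b) True | _ \<Rightarrow> c)) () (\<lambda>_. []) (\<lambda>_. ()) (\<lambda>_ c. ((), Some c))"

lemma sweep_a: "sweep_a (path_word l xs b ys) = path_word l xs (\<not> b) ys"
proof -
  let ?\<delta> = "\<lambda>(_ :: unit) c. ((), case c of U b True \<Rightarrow> U (\<not> b) True | _ \<Rightarrow> c)"
  have copy: "rsweep ?\<delta> () (map (\<lambda>x. U x False) xs) = (map (\<lambda>x. U x False) xs, ())"
     "rsweep ?\<delta> () (replicate n P) = (replicate n P, ())" "rsweep ?\<delta> () (replicate n T) = (replicate n T, ())"
     for xs n by (rule rsweep_copy; auto)+
  have "lsweep (\<lambda>(_ :: unit) c. ((), Some c)) () w = (map Some w, ())" for w :: "letter list"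
    by (rule lsweep_copy) simp
  thus ?thesis
    by (simp add: sweep_a_def two_sweeps_def path_word_def rsweep_append copy del: replicate.simps)
qed

subsection \<open>Moving forwards\<close>

datatype forward_right = F_Start | F_Prefix | F_Lamps | F_Mark bool | F_Rest bool | F_Extend bool
datatype forward_left = F_Idle | F_Drop bool | F_Shift "letter option" "letter option"

fun forward_step :: "forward_right \<Rightarrow> letter \<Rightarrow> forward_right \<times> letter" where
  "forward_step F_Start P = (F_Prefix, P)"
| "forward_step F_Start (U b True) = (F_Mark False, U b False)"
| "forward_step F_Start (U b False) = (F_Lamps, U b False)"
| "forward_step F_Prefix (U b True) = (F_Mark (\<not> b), U b False)"
| "forward_step F_Prefix (U b False) = (F_Lamps, U b False)"
| "forward_step F_Lamps (U b True) = (F_Mark False, U b False)"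
| "forward_step (F_Mark trim) (U b h) = (F_Rest trim, U b True)"
| "forward_step (F_Mark trim) T = (F_Extend trim, U False True)"
| "forward_step q a = (q, a)"

fun forward_end :: "forward_right \<Rightarrow> letter list" where
  "forward_end (F_Extend trim) = [T]"
| "forward_end q = []"

fun forward_turn :: "forward_right \<Rightarrow> forward_left" where
  "forward_turn (F_Rest trim) = F_Drop trim"
| "forward_turn (F_Extend True) = F_Shift None None"
| "forward_turn q = F_Idle"

fun forward_back :: "forward_left \<Rightarrow> letter \<Rightarrow> forward_left \<times> letter option" where
  "forward_back F_Idle a = (F_Idle, Some a)"
| "forward_back (F_Drop trim) a = (if trim then F_Shift None None else F_Idle, None)"
| "forward_back (F_Shift c d) P = (F_Idle, c)"
| "forward_back (F_Shift c d) a = (F_Shift d (Some a), c)"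

text \<open>The sweep to the right moves the mark to the next lamp. If there is none, the first step back becomes an unlit marked lamp,
and a step back is appended to make up for it; otherwise one step back has to be dropped. The flag of a state tells
that the path left an unlit lamp at the left end, so that this lamp and one letter \<open>P\<close> have to go. Then the sweep to
the left shifts the word by two places, up to the last \<open>P\<close>, which is overwritten along with the lamp. The letters \<open>P\<close>
further to the left are all alike and stay.\<close>

definition sweep_t :: "letter list \<Rightarrow> letter list" where
  "sweep_t = two_sweeps forward_step F_Start forward_end forward_turn forward_back"

lemma forward_replicate_P: "rsweep forward_step F_Prefix (replicate l P) = (replicate l P, F_Prefix)"
  by (rule rsweep_copy) auto

lemma forward_prefix:
  "rsweep forward_step F_Start (replicate l P) = (replicate l P, if l = 0 then F_Start else F_Prefix)"
  by (cases l) (simp_all add: forward_replicate_P)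

lemma forward_lamps:
  "rsweep forward_step F_Lamps (map (\<lambda>x. U x False) xs) = (map (\<lambda>x. U x False) xs, F_Lamps)"
  by (rule rsweep_copy) auto

lemma forward_to_mark:
  "rsweep forward_step F_Start (replicate l P @ map (\<lambda>x. U x False) xs @ [U b True]) =
     (replicate l P @ map (\<lambda>x. U x False) xs @ [U b False], F_Mark (l > 0 \<and> xs = [] \<and> \<not> b))"
  by (cases xs) (simp_all add: rsweep_append forward_prefix forward_lamps split_beta)

lemma forward_rest: "rsweep forward_step (F_Rest trim) w = (w, F_Rest trim)"
  "rsweep forward_step (F_Extend trim) w = (w, F_Extend trim)"
  by (rule rsweep_copy; case_tac a; simp)+

lemma forward_idle: "lsweep forward_back F_Idle w = (map Some w, F_Idle)"
  by (rule lsweep_copy) simp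

text \<open>The two letters held in the state are those read last, so a word without \<open>P\<close> is shifted by two places.\<close>

lemma forward_shift:
  assumes "P \<notin> set (x # y # w)"
  shows "lsweep forward_back (F_Shift None None) (x # y # w) = (map Some w @ [None, None], F_Shift (Some y) (Some x))"
  using assms
proof (induction w arbitrary: x y)
  case Nil
  thus ?case by (cases x; cases y) auto
next
  case (Cons z w)
  hence "lsweep forward_back (F_Shift None None) (y # z # w) =
    (map Some w @ [None, None], F_Shift (Some z) (Some y))" by simp
  thus ?case using Cons.prems by (subst lsweep.simps(2)) (cases x; simp)
qed

lemma forward_trim:
  assumes "P \<notin> set (x # y # w)"
  shows "lsweep forward_back (F_Shift None None) (replicate (Suc l) P @ x # y # w) =
    (map Some (replicate l P @ y # w) @ [None, None], F_Idle)"
proof -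
  have "lsweep forward_back (F_Shift None None) (P # x # y # w) = (Some y # map Some w @ [None, None], F_Idle)"
    by (subst lsweep.simps(2), subst forward_shift[OF assms]) simp
  moreover have "replicate (Suc l) P @ x # y # w = replicate l P @ (P # x # y # w)"
    by (simp add: replicate_app_Cons_same)
  ultimately show ?thesis
    by (simp only: lsweep_append forward_idle fst_conv snd_conv) simp
qed

lemma forward_marked:
  defines "trim \<equiv> \<lambda>l xs b. l > 0 \<and> xs = [] \<and> \<not> b"
  shows "rsweep forward_step F_Start (replicate l P @ map (\<lambda>x. U x False) xs @ U b True # U y False # w) =
      (replicate l P @ map (\<lambda>x. U x False) xs @ U b False # U y True # w, F_Rest (trim l xs b))"
    "rsweep forward_step F_Start (replicate l P @ map (\<lambda>x. U x False) xs @ U b True # T # w) =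
      (replicate l P @ map (\<lambda>x. U x False) xs @ U b False # U False True # w, F_Extend (trim l xs b))"
  using rsweep_appendI[OF forward_to_mark[of l xs b], of "U y False # w"]
    rsweep_appendI[OF forward_to_mark[of l xs b], of "T # w"]
  by (simp_all add: forward_rest trim_def)

lemma sweep_t:
  assumes "\<not> (l > 0 \<and> xs = [] \<and> \<not> b)"
  shows "sweep_t (path_word l xs b (y # ys)) = path_word l (xs @ [b]) y ys"
    "sweep_t (path_word l xs b []) = path_word l (xs @ [b]) False []"
proof -
  let ?v = "replicate l P @ map (\<lambda>x. U x False) xs @ U b False # U y True # map (\<lambda>x. U x False) ys
    @ replicate (Suc (length ys)) T"
  have v: "?v = path_word l (xs @ [b]) y ys" by (simp add: path_word_def)
  show "sweep_t (path_word l xs b (y # ys)) = path_word l (xs @ [b]) y ys"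
    unfolding sweep_t_def
  proof (rule two_sweepsI)
    show "rsweep forward_step F_Start (path_word l xs b (y # ys)) = (?v @ [T], F_Rest False)"
      using assms by (auto simp: path_word_def forward_marked replicate_append_same)
    show "lsweep forward_back (forward_turn (F_Rest False)) ((?v @ [T]) @ forward_end (F_Rest False)) =
        (map Some ?v @ [None], F_Idle)"
      unfolding forward_end.simps append_Nil2 by (subst lsweep_append) (simp add: forward_idle del: replicate.simps)
    show "output_of (map Some ?v @ [None]) = path_word l (xs @ [b]) y ys"
      unfolding v by (rule output_of_Some(2))
  qed
  show "sweep_t (path_word l xs b []) = path_word l (xs @ [b]) False []"
    unfolding sweep_t_def
  proof (rule two_sweepsI)
    show "rsweep forward_step F_Start (path_word l xs b []) =
        (replicate l P @ map (\<lambda>x. U x False) xs @ [U b False, U False True], F_Extend False)"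
      using assms by (auto simp: path_word_def forward_marked)
    show "lsweep forward_back (forward_turn (F_Extend False))
        ((replicate l P @ map (\<lambda>x. U x False) xs @ [U b False, U False True]) @ forward_end (F_Extend False)) =
        (map Some (path_word l (xs @ [b]) False []), F_Idle)"
      by (simp add: forward_idle path_word_def)
  qed (rule output_of_Some(1))
qed

lemma sweep_t_trim:
  "sweep_t (path_word (Suc l) [] False (y # ys)) = path_word l [] y ys"
  "sweep_t (path_word (Suc l) [] False []) = path_word l [] False []"
proof -
  let ?w = "map (\<lambda>x. U x False) ys @ replicate (Suc (length ys)) T"
  let ?v = "replicate (Suc l) P @ U False False # U y True # ?w"
  show "sweep_t (path_word (Suc l) [] False (y # ys)) = path_word l [] y ys"
    unfolding sweep_t_def
  proof (rule two_sweepsI)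
    show "rsweep forward_step F_Start (path_word (Suc l) [] False (y # ys)) = (?v @ [T], F_Rest True)"
      using forward_marked(1)[of "Suc l" "[]" False y]
      by (simp add: path_word_def replicate_append_same del: replicate.simps(2)) (simp add: replicate_append_same)
    have "lsweep forward_back (F_Shift None None) ?v = (map Some (replicate l P @ U y True # ?w) @ [None, None], F_Idle)"
      by (rule forward_trim) auto
    thus "lsweep forward_back (forward_turn (F_Rest True)) ((?v @ [T]) @ forward_end (F_Rest True)) =
        (map Some (path_word l [] y ys) @ None # [None, None], F_Idle)"
      unfolding forward_end.simps append_Nil2 lsweep_append[of _ _ ?v] by (simp add: path_word_def del: replicate.simps)
  qed (rule output_of_Some(2))
  show "sweep_t (path_word (Suc l) [] False []) = path_word l [] False []"
    unfolding sweep_t_def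
  proof (rule two_sweepsI)
    show "rsweep forward_step F_Start (path_word (Suc l) [] False []) =
        (replicate (Suc l) P @ [U False False, U False True], F_Extend True)"
      using forward_marked(2)[of "Suc l" "[]" False "[]"] by (simp add: path_word_def)
    show "lsweep forward_back (forward_turn (F_Extend True))
        ((replicate (Suc l) P @ [U False False, U False True]) @ forward_end (F_Extend True)) =
        (map Some (path_word l [] False []) @ None # [None], F_Idle)"
      using forward_trim[of "U False False" "U False True" "[T]" l] by (simp add: path_word_def)
  qed (rule output_of_Some(2))
qed

subsection \<open>Moving backwards\<close>

datatype backward_right = B_Start | B_First bool | B_Insert letter letter | B_Extend | B_Lamps | B_Mark bool | B_Rest | B_Trim
datatype backward_left = B_Idle | B_Find | B_Moved | B_Drop | B_Drop2

fun backward_step :: "backward_right \<Rightarrow> letter \<Rightarrow> backward_right \<times> letter" where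
  "backward_step B_Start P = (B_Start, P)"
| "backward_step B_Start (U b True) = (B_First b, P)"
| "backward_step B_Start (U b False) = (B_Lamps, U b False)"
| "backward_step (B_First False) T = (B_Extend, U False True)"
| "backward_step (B_First b) a = (B_Insert (U b False) a, U False True)"
| "backward_step (B_Insert c d) a = (B_Insert d a, c)"
| "backward_step B_Lamps (U b True) = (B_Mark b, U b True)"
| "backward_step (B_Mark False) T = (B_Trim, T)"
| "backward_step (B_Mark b) a = (B_Rest, a)"
| "backward_step q a = (q, a)"

fun backward_end :: "backward_right \<Rightarrow> letter list" where
  "backward_end (B_Insert c d) = [c, d, T]"
| "backward_end B_Extend = [T]"
| "backward_end B_Rest = [T]"
| "backward_end q = []"

fun backward_turn :: "backward_right \<Rightarrow> backward_left" where
  "backward_turn B_Rest = B_Find"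
| "backward_turn B_Trim = B_Drop"
| "backward_turn q = B_Idle"

fun backward_back :: "backward_left \<Rightarrow> letter \<Rightarrow> backward_left \<times> letter option" where
  "backward_back B_Find (U b True) = (B_Moved, Some (U b False))"
| "backward_back B_Moved (U b False) = (B_Idle, Some (U b True))"
| "backward_back B_Drop a = (B_Drop2, None)"
| "backward_back B_Drop2 a = (B_Moved, Some T)"
| "backward_back p a = (p, Some a)"

text \<open>If there are lamps before the marked one, the mark has to move to the left, which is the work of the sweep to the left. It
drops the lamp left behind if that is unlit and the last one: the last \<open>T\<close> is erased and the lamp is overwritten
by the remaining \<open>T\<close>. If the marked lamp is the first one, the sweep to the right inserts a letter \<open>P\<close> and an unlit marked
lamp, and shifts the rest of the word by two places. If in this case the old lamp is unlit and the last one, it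
is not copied, and the word becomes longer by one letter \<open>P\<close> only.\<close>

definition sweep_T :: "letter list \<Rightarrow> letter list" where
  "sweep_T = two_sweeps backward_step B_Start backward_end backward_turn backward_back"

lemma lsweep_appendI:
  "lsweep \<epsilon> p v = (v', p') \<Longrightarrow> lsweep \<epsilon> p' u = (u', p'') \<Longrightarrow> lsweep \<epsilon> p (u @ v) = (u' @ v', p'')"
  by (simp add: lsweep_append)

lemma backward_idle: "lsweep backward_back B_Idle w = (map Some w, B_Idle)"
  by (rule lsweep_copy) simp

lemma backward_prefix: "rsweep backward_step B_Start (replicate l P) = (replicate l P, B_Start)"
  by (rule rsweep_copy) auto

lemma backward_lamps:
  "rsweep backward_step B_Lamps (map (\<lambda>x. U x False) xs) = (map (\<lambda>x. U x False) xs, B_Lamps)"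
  by (rule rsweep_copy) auto

lemma backward_rest: "rsweep backward_step B_Rest w = (w, B_Rest)"
  by (rule rsweep_copy) (case_tac a; simp)

lemma backward_insert:
  "\<exists>v c' d'. rsweep backward_step (B_Insert c d) w = (v, B_Insert c' d') \<and> v @ [c', d'] = c # d # w"
proof (induction w arbitrary: c d)
  case (Cons a w)
  obtain v c' d' where "rsweep backward_step (B_Insert d a) w = (v, B_Insert c' d')" "v @ [c', d'] = d # a # w"
    using Cons.IH by blast
  thus ?case by (intro exI[of _ "c # v"]) auto
qed auto

lemma backward_to_mark:
  "xs \<noteq> [] \<Longrightarrow> rsweep backward_step B_Start (replicate l P @ map (\<lambda>x. U x False) xs @ [U b True]) =
     (replicate l P @ map (\<lambda>x. U x False) xs @ [U b True], B_Mark b)"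
  by (cases xs) (simp_all add: rsweep_append backward_prefix backward_lamps split_beta)

lemma backward_mark:
  "lsweep backward_back B_Moved (replicate l P @ map (\<lambda>x. U x False) (xs @ [x])) =
     (map Some (replicate l P @ map (\<lambda>x. U x False) xs @ [U x True]), B_Idle)"
proof -
  have "replicate l P @ map (\<lambda>x. U x False) (xs @ [x]) = (replicate l P @ map (\<lambda>x. U x False) xs) @ [U x False]"
    by simp
  thus ?thesis by (simp only: lsweep_append) (simp add: backward_idle)
qed

lemma sweep_T:
  assumes "b \<or> ys \<noteq> []"
  shows "sweep_T (path_word l (xs @ [x]) b ys) = path_word l xs x (b # ys)"
  unfolding sweep_T_def
proof (rule two_sweepsI)
  let ?u = "replicate l P @ map (\<lambda>x. U x False) (xs @ [x])"
  let ?w = "map (\<lambda>x. U x False) ys @ replicate (Suc (length ys)) T"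
  have "rsweep backward_step (B_Mark b) ?w = (?w, B_Rest)"
    using assms by (cases ys; cases b) (simp_all add: backward_rest)
  thus "rsweep backward_step B_Start (path_word l (xs @ [x]) b ys) = (path_word l (xs @ [x]) b ys, B_Rest)"
    using rsweep_appendI[OF backward_to_mark[of "xs @ [x]" l b], of ?w] by (simp add: path_word_def)
  let ?w' = "map (\<lambda>x. U x False) ys @ replicate (Suc (Suc (length ys))) T"
  have eq: "path_word l (xs @ [x]) b ys @ backward_end B_Rest = ?u @ U b True # ?w'"
    by (simp add: path_word_def replicate_append_same)
  have find: "lsweep backward_back B_Find ?w' = (map Some ?w', B_Find)" by (rule lsweep_copy) auto
  have "lsweep backward_back B_Find (U b True # ?w') = (map Some (U b False # ?w'), B_Moved)"
    by (subst lsweep.simps(2), subst find) simp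
  hence "lsweep backward_back B_Find (?u @ U b True # ?w') =
      (map Some (replicate l P @ map (\<lambda>x. U x False) xs @ [U x True]) @ map Some (U b False # ?w'), B_Idle)"
    by (rule lsweep_appendI[OF _ backward_mark])
  also have "map Some (replicate l P @ map (\<lambda>x. U x False) xs @ [U x True]) @ map Some (U b False # ?w') =
      map Some (path_word l xs x (b # ys))"
    by (simp add: path_word_def)
  finally show "lsweep backward_back (backward_turn B_Rest) (path_word l (xs @ [x]) b ys @ backward_end B_Rest) =
      (map Some (path_word l xs x (b # ys)), B_Idle)"
    unfolding eq by simp
qed (rule output_of_Some(1))

lemma sweep_T_trim: "sweep_T (path_word l (xs @ [x]) False []) = path_word l xs x []"
  unfolding sweep_T_def
proof (rule two_sweepsI)
  let ?u = "replicate l P @ map (\<lambda>x. U x False) (xs @ [x])"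
  show "rsweep backward_step B_Start (path_word l (xs @ [x]) False []) = (?u @ [U False True, T], B_Trim)"
    using rsweep_appendI[OF backward_to_mark[of "xs @ [x]" l False], of "[T]"] by (simp add: path_word_def)
  have "lsweep backward_back B_Drop (?u @ [U False True, T]) =
     (map Some (replicate l P @ map (\<lambda>x. U x False) xs @ [U x True]) @ [Some T, None], B_Idle)"
    by (rule lsweep_appendI[OF _ backward_mark]) simp
  thus "lsweep backward_back (backward_turn B_Trim) ((?u @ [U False True, T]) @ backward_end B_Trim) =
     (map Some (path_word l xs x []) @ None # [], B_Idle)"
    by (simp add: path_word_def)
qed (rule output_of_Some(2))

lemma sweep_T_insert:
  assumes "b \<or> ys \<noteq> []"
  shows "sweep_T (path_word l [] b ys) = path_word (Suc l) [] False (b # ys)"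
proof -
  let ?r = "map (\<lambda>x. U x False) ys @ replicate (Suc (length ys)) T"
  obtain c w where r: "?r = c # w" by (cases ?r) auto
  have "c \<noteq> T \<or> b" using assms r by (cases ys) auto
  hence first: "backward_step (B_First b) c = (B_Insert (U b False) c, U False True)"
    by (cases b; cases c) auto
  obtain v c' d' where v: "rsweep backward_step (B_Insert (U b False) c) w = (v, B_Insert c' d')"
    "v @ [c', d'] = U b False # c # w" using backward_insert by blast
  have word: "path_word l [] b ys = replicate l P @ U b True # c # w"
    using r by (simp add: path_word_def)
  show ?thesis unfolding sweep_T_def
  proof (rule two_sweepsI)
    show "rsweep backward_step B_Start (path_word l [] b ys) = (replicate l P @ P # U False True # v, B_Insert c' d')"
      unfolding word rsweep_append by (simp add: backward_prefix first v(1))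
    have "replicate l P @ P # U False True # (v @ [c', d']) @ [T] = replicate l P @ P # U False True # U b False # (?r @ [T])"
      by (simp only: v(2) r append_Cons)
    also have "\<dots> = path_word (Suc l) [] False (b # ys)"
      by (simp add: path_word_def replicate_append_same replicate_app_Cons_same)
    finally have "replicate l P @ P # U False True # (v @ [c', d']) @ [T] = path_word (Suc l) [] False (b # ys)" .
    thus "lsweep backward_back (backward_turn (B_Insert c' d'))
        ((replicate l P @ P # U False True # v) @ backward_end (B_Insert c' d')) =
        (map Some (path_word (Suc l) [] False (b # ys)), B_Idle)"
      by (simp add: backward_idle)
  qed (rule output_of_Some(1))
qed

lemma sweep_T_extend: "sweep_T (path_word l [] False []) = path_word (Suc l) [] False []"
  unfolding sweep_T_def
proof (rule two_sweepsI)
  show "rsweep backward_step B_Start (path_word l [] False []) = (replicate l P @ [P, U False True], B_Extend)"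
    by (simp add: path_word_def rsweep_append backward_prefix)
  show "lsweep backward_back (backward_turn B_Extend) ((replicate l P @ [P, U False True]) @ backward_end B_Extend) =
      (map Some (path_word (Suc l) [] False []), B_Idle)"
    by (simp add: backward_idle path_word_def replicate_app_Cons_same)
qed (rule output_of_Some(1))

section \<open>The representation by paths\<close>

lemma path_words_cases:
  assumes "w \<in> path_words"
  obtains l xs b ys where "w = path_word l xs b ys" "trimmed l xs ys"
  using assms by (auto simp: path_words_def)

lemma path_word_in: "trimmed l xs ys \<Longrightarrow> path_word l xs b ys \<in> path_words"
  by (auto simp: path_words_def)

lemma sweep_a_correct:
  assumes "w \<in> path_words"
  shows "sweep_a w \<in> path_words \<and> path_value (sweep_a w) = lmult (path_value w) gen_a"
  using assms
proof (rule path_words_cases)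
  fix l xs b ys assume w: "w = path_word l xs b ys" "trimmed l xs ys"
  show ?thesis unfolding w(1) sweep_a
    using w(2) by (auto simp: path_word_in path_value_path_word lmult_gens fset_eq_iff)
qed

lemma sweep_t_correct:
  assumes "w \<in> path_words"
  shows "sweep_t w \<in> path_words \<and> path_value (sweep_t w) = lmult (path_value w) gen_t"
  using assms
proof (rule path_words_cases)
  fix l xs b ys assume w: "w = path_word l xs b ys" "trimmed l xs ys"
  show ?thesis
  proof (cases "l > 0 \<and> xs = [] \<and> \<not> b")
    case True
    then obtain k where k: "l = Suc k" "xs = []" "b = False" by (cases l) auto
    show ?thesis
    proof (cases ys)
      case Nil
      show ?thesis unfolding w(1) k Nil sweep_t_trim
        by (auto simp: path_word_in trimmed_def path_value_path_word lmult_gens)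
    next
      case (Cons y ys')
      show ?thesis unfolding w(1) k Cons sweep_t_trim
        using w(2) by (auto simp: Cons k path_word_in trimmed_def path_value_path_word lmult_gens split: if_splits)
    qed
  next
    case False
    show ?thesis
    proof (cases ys)
      case Nil
      show ?thesis unfolding w(1) Nil sweep_t(2)[OF False]
        using w(2) False by (auto simp: path_word_in trimmed_def path_value_path_word lmult_gens hd_append)
    next
      case (Cons y ys')
      show ?thesis unfolding w(1) Cons sweep_t(1)[OF False]
        using w(2) False
        by (auto simp: Cons path_word_in trimmed_def path_value_path_word lmult_gens hd_append algebra_simps split: if_splits)
    qed
  qed
qed

lemma sweep_T_correct:
  assumes "w \<in> path_words"
  shows "sweep_T w \<in> path_words \<and> path_value (sweep_T w) = lmult (path_value w) gen_T"
  using assms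
proof (rule path_words_cases)
  fix l xs b ys assume w: "w = path_word l xs b ys" "trimmed l xs ys"
  show ?thesis
  proof (cases xs rule: rev_cases)
    case Nil
    show ?thesis
    proof (cases "b \<or> ys \<noteq> []")
      case True
      show ?thesis unfolding w(1) Nil sweep_T_insert[OF True]
        using w(2) True by (auto simp: path_word_in trimmed_def path_value_path_word lmult_gens split: if_splits)
    next
      case False
      hence "b = False" "ys = []" by auto
      thus ?thesis unfolding w(1) Nil
        by (auto simp: sweep_T_extend path_word_in trimmed_def path_value_path_word lmult_gens)
    qed
  next
    case (snoc xs' x)
    show ?thesis
    proof (cases "b \<or> ys \<noteq> []")
      case True
      show ?thesis unfolding w(1) snoc sweep_T[OF True]
        using w(2) True
        by (auto simp: snoc path_word_in trimmed_def path_value_path_word lmult_gens hd_append algebra_simps split: if_splits)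
    next
      case False
      hence "b = False" "ys = []" by auto
      thus ?thesis unfolding w(1) snoc
        using w(2) by (auto simp: snoc sweep_T_trim path_word_in trimmed_def path_value_path_word lmult_gens hd_append split: if_splits)
    qed
  qed
qed

lemma (in group) cayley_distance_vanishesI:
  assumes ne: "L \<noteq> {}" and cl: "\<And>w. w \<in> L \<Longrightarrow> word_prod G (map \<alpha> w) \<in> carrier G"
  shows "cayley_distance_vanishes G A L (\<lambda>w. word_prod G (map \<alpha> w)) \<alpha>"
  unfolding cayley_distance_vanishes_def
proof (intro allI impI)
  fix n assume n: "lang_min_length L \<le> n"
  obtain w where "w \<in> L" using ne by blast
  hence "lang_upto L (length w) \<noteq> {}" by (auto simp: lang_upto_def)
  hence "lang_upto L (lang_min_length L) \<noteq> {}" unfolding lang_min_length_def by (rule LeastI)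
  hence "lang_upto L n \<noteq> {}" using n by (force simp: lang_upto_def)
  hence "(\<lambda>w. real (word_dist G A (word_prod G (map \<alpha> w)) (word_prod G (map \<alpha> w)))) ` lang_upto L n = {0}"
    using cl by (force simp: lang_upto_def word_dist_self)
  thus "cayley_distance G A L (\<lambda>w. word_prod G (map \<alpha> w)) \<alpha> n = 0"
    by (simp add: cayley_distance_def)
qed

lemma UNIV_forward_right:
  "UNIV = {F_Start, F_Prefix, F_Lamps} \<union> range F_Mark \<union> range F_Rest \<union> range F_Extend" (is "_ = ?A")
proof -
  have "q \<in> ?A" for q by (cases q) auto
  thus ?thesis by blast
qed

instance forward_right :: finite by standard (subst UNIV_forward_right, simp)

lemma UNIV_forward_left:
  "UNIV = {F_Idle} \<union> range F_Drop \<union> range (case_prod F_Shift)" (is "_ = ?A")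
proof -
  have "q \<in> ?A" for q by (cases q) auto
  thus ?thesis by blast
qed

instance forward_left :: finite by standard (subst UNIV_forward_left, simp)

lemma UNIV_backward_right:
  "UNIV = {B_Start, B_Extend, B_Lamps, B_Rest, B_Trim} \<union> range B_First \<union> range B_Mark \<union> range (case_prod B_Insert)" (is "_ = ?A")
proof -
  have "q \<in> ?A" for q by (cases q) auto
  thus ?thesis by blast
qed

instance backward_right :: finite by standard (subst UNIV_backward_right, simp)

lemma UNIV_backward_left: "UNIV = {B_Idle, B_Find, B_Moved, B_Drop, B_Drop2}" (is "_ = ?A")
proof -
  have "q \<in> ?A" for q by (cases q) auto
  thus ?thesis by blast
qed

instance backward_left :: finite by standard (subst UNIV_backward_left, simp)

definition letter_of :: "nat \<Rightarrow> letter" where "letter_of = inv_into UNIV letter_code"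

lemma letter_of_code [simp]: "letter_of (letter_code c) = c"
  using inj_letter_code by (simp add: letter_of_def)

definition letter_element :: "nat \<Rightarrow> nat" where "letter_element n = code (letter_value (letter_of n))"

definition encoded_paths :: "nat list set" where "encoded_paths = map letter_code ` path_words"

lemma encoded_path_value:
  "word_prod lamplighter (map letter_element (map letter_code w)) = code (path_value w)"
proof -
  have "map letter_element (map letter_code w) = map code (map letter_value w)"
    by (simp add: letter_element_def)
  thus ?thesis by (simp only: word_prod_map_code path_value_def)
qed

lemma sweeps_linear_time:
  fixes \<delta> :: "'q::finite \<Rightarrow> letter \<Rightarrow> 'q \<times> letter" and \<kappa> :: "'q \<Rightarrow> 'p::finite"
  shows "pf_linear_time (range letter_code) (\<lambda>x. map letter_code (two_sweeps \<delta> q0 \<rho> \<kappa> \<epsilon> (map letter_of x)))"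
proof -
  interpret sweep_machine \<delta> q0 \<rho> \<kappa> \<epsilon> letter_code by unfold_locales (rule inj_letter_code)
  show ?thesis using pf_linear_time_two_sweeps unfolding dec_def letter_of_def .
qed

lemma generator_sweeps:
  assumes "s \<in> sym_gens lamplighter lamp_gens"
  obtains f g where "s = code g" "pf_linear_time (range letter_code) (\<lambda>x. map letter_code (f (map letter_of x)))"
    "\<And>w. w \<in> path_words \<Longrightarrow> f w \<in> path_words \<and> path_value (f w) = lmult (path_value w) g"
proof -
  consider "s = code gen_a" | "s = code gen_t" | "s = code gen_T"
    using assms by (auto simp: sym_gens_lamplighter)
  thus thesis
  proof cases
    case 1
    thus thesis by (rule that[OF _ _ sweep_a_correct]) (auto simp: sweep_a_def intro: sweeps_linear_time)
  next
    case 2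
    thus thesis by (rule that[OF _ _ sweep_t_correct]) (auto simp: sweep_t_def intro: sweeps_linear_time)
  next
    case 3
    thus thesis by (rule that[OF _ _ sweep_T_correct]) (auto simp: sweep_T_def intro: sweeps_linear_time)
  qed
qed

text \<open>The empty path belongs to the neutral element, and the sweeps follow the generators from there to every element.\<close>

lemma path_value_surj: "\<exists>w \<in> path_words. path_value w = g"
proof -
  have "\<exists>w \<in> path_words. code (path_value w) = word_prod lamplighter ss"
    if "ss \<in> lists (sym_gens lamplighter lamp_gens)" for ss
    using that
  proof (induction ss rule: rev_induct)
    case Nil
    have "path_value (path_word 0 [] False []) = ({||}, 0)" by (simp add: path_value_path_word)
    thus ?case by (intro bexI[of _ "path_word 0 [] False []"])
      (auto simp: one_lamplighter trimmed_def intro: path_word_in)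
  next
    case (snoc s ss)
    hence s: "s \<in> sym_gens lamplighter lamp_gens" and ss: "ss \<in> lists (sym_gens lamplighter lamp_gens)" by auto
    obtain w where w: "w \<in> path_words" "code (path_value w) = word_prod lamplighter ss" using snoc.IH[OF ss] by blast
    obtain f g where f: "s = code g" "\<And>w. w \<in> path_words \<Longrightarrow> f w \<in> path_words \<and> path_value (f w) = lmult (path_value w) g"
      using generator_sweeps[OF s] by metis
    have "word_prod lamplighter (ss @ [s]) = word_prod lamplighter ss \<otimes>\<^bsub>lamplighter\<^esub> s"
      using LL.gens_words_closed[OF _ ss] LL.gens_words_closed[of lamp_gens "[s]"] s
      by (simp del: in_lists_conv_set lists_image)
    also have "\<dots> = code (path_value (f w))" using f(2)[OF w(1)] by (simp add: f(1) flip: w(2))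
    finally show ?case using f(2)[OF w(1)] by (intro bexI[of _ "f w"]) auto
  qed
  moreover have "\<exists>ss \<in> lists (sym_gens lamplighter lamp_gens). word_prod lamplighter ss = code g"
    using LL.generate_as_word[of lamp_gens "code g"] finite_generating_set_lamplighter
    by (auto simp: finite_generating_set_def)
  ultimately show ?thesis by (metis code_eq_iff)
qed

lemma encoded_paths_rep:
  "cayley_pf_linear_time_rep lamplighter lamp_gens (range letter_code) encoded_paths
     (\<lambda>w. word_prod lamplighter (map letter_element w))"
  unfolding cayley_pf_linear_time_rep_def
proof (intro conjI ballI)
  let ?\<psi> = "\<lambda>w. word_prod lamplighter (map letter_element w)"
  show "finite (range letter_code)" by simp
  show "encoded_paths \<subseteq> lists (range letter_code)" by (auto simp: encoded_paths_def)
  have "inj_on path_value path_words"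
    by (rule inj_onI) (auto simp: path_words_def dest!: trimmed_unique)
  hence "bij_betw path_value path_words UNIV"
    using path_value_surj by (auto simp: bij_betw_def image_iff) metis
  hence "inj_on path_value path_words" "path_value ` path_words = UNIV" by (auto simp: bij_betw_def)
  moreover have "?\<psi> ` encoded_paths = code ` path_value ` path_words"
    by (simp add: encoded_paths_def image_image encoded_path_value del: map_map)
  moreover have "inj_on ?\<psi> encoded_paths" if "inj_on path_value path_words"
    using that by (auto simp: encoded_paths_def inj_on_def encoded_path_value simp del: map_map)
  ultimately show "bij_betw ?\<psi> encoded_paths (carrier lamplighter)"
    by (simp add: bij_betw_def)
  fix s assume "s \<in> sym_gens lamplighter lamp_gens"
  then obtain f g where f: "s = code g" "pf_linear_time (range letter_code) (\<lambda>x. map letter_code (f (map letter_of x)))"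
    "\<And>w. w \<in> path_words \<Longrightarrow> f w \<in> path_words \<and> path_value (f w) = lmult (path_value w) g"
    by (rule generator_sweeps) (rule that; assumption)
  let ?f = "\<lambda>x. map letter_code (f (map letter_of x))"
  have enc: "?f (map letter_code w) = map letter_code (f w)" for w by (simp add: comp_def)
  show "\<exists>f. pf_linear_time (range letter_code) f \<and> f ` encoded_paths \<subseteq> encoded_paths \<and>
      (\<forall>w \<in> encoded_paths. ?\<psi> (f w) = ?\<psi> w \<otimes>\<^bsub>lamplighter\<^esub> s)"
  proof (intro exI[of _ ?f] conjI ballI)
    show "?f ` encoded_paths \<subseteq> encoded_paths"
      using f(3) by (auto simp: encoded_paths_def comp_def)
    fix x assume "x \<in> encoded_paths"
    then obtain w where w: "w \<in> path_words" "x = map letter_code w" by (auto simp: encoded_paths_def)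
    show "?\<psi> (?f x) = ?\<psi> x \<otimes>\<^bsub>lamplighter\<^esub> s"
      unfolding w(2) enc encoded_path_value f(1) using f(3)[OF w(1)] by simp
  qed (rule f(2))
qed

theorem theorem14:
  "\<exists>(G :: nat monoid) A.
     group G \<and> finite_generating_set G A \<and>
     cayley_automatic G A \<and> separated_from_automatic G A \<and>
     (\<exists>(\<Sigma> :: nat set) L \<psi> \<alpha>.
        cayley_pf_linear_time_rep G A \<Sigma> L \<psi> \<and> \<alpha> \<in> \<Sigma> \<rightarrow> carrier G \<and>
        cayley_distance_vanishes G A L \<psi> \<alpha>)"
proof (intro exI conjI)
  show "group lamplighter" by (rule LL.group_axioms)
  show "finite_generating_set lamplighter lamp_gens" by (rule finite_generating_set_lamplighter)
  show "cayley_automatic lamplighter lamp_gens" by (rule cayley_automatic_lamplighter)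
  show "separated_from_automatic lamplighter lamp_gens" by (rule separated_lamplighter)
  show "cayley_pf_linear_time_rep lamplighter lamp_gens (range letter_code) encoded_paths
      (\<lambda>w. word_prod lamplighter (map letter_element w))"
    by (rule encoded_paths_rep)
  show "letter_element \<in> range letter_code \<rightarrow> carrier lamplighter"
    by (auto simp: letter_element_def)
  show "cayley_distance_vanishes lamplighter lamp_gens encoded_paths
      (\<lambda>w. word_prod lamplighter (map letter_element w)) letter_element"
  proof (rule LL.cayley_distance_vanishesI)
    show "encoded_paths \<noteq> {}" by (auto simp: encoded_paths_def path_words_def trimmed_def)
    show "word_prod lamplighter (map letter_element w) \<in> carrier lamplighter" for w
      by (rule LL.word_prod_closed) (auto simp: letter_element_def)
  qed
qed

end
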